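(* Fix $d\ge2$ and $q\in[1,d)$. Consider the minimum spanning tree problem with $n$ i.i.d. input points $\mathbf X^n=(X_{n,1},\dots,X_{n,n})$ from a probability measure $\mathcal P$ on $\mathbb R^d$: minimize $\sum_{\{i,j\}\in E(G)}\|X_{n,i}-X_{n,j}\|_2^q$ over $G\in\mathcal G_n$, where $\mathcal G_n$ is the collection of all trees with vertex set $[n]$ and vertex degrees bounded by $\kappa(d)$, the kissing number of $\mathbb R^d$. Assume: 1. $\mathcal P$ has a density $f$ with respect to Lebesgue measure on $\mathbb R^d$ which is bounded and almost everywhere continuous, and $\mathbb E_{\mathcal P}\|X\|_2^q<\infty$; 2. $\displaystyle\mathbb E\Bigl[\inf_{G\in\mathcal G_n}\sum_{\{i,j\}\in E(G)}\|X_{n,i}-X_{n,j}\|_2^q\Bigr]=O\bigl(n^{(d-q)/d}\bigr)$ as $n\to\infty$; 3. $\mathcal P$ satisfies the Langevin assumption of the context for a pair $(\rho,g)$ with $\nabla g\ne0$ almost everywhere; or, in case $q\in[1,1+2/d)$, alternatively $\mathcal P$ satisfies the rejection assumption of the context; 4. with $A_k$ the annular shell in $\mathbb R^d$ centred at $\mathbf 0$ with inner radius $2^k$ and outer radius $2^{k+1}$, and $a_{k,q}(f)=2^{kdq/(d-q)}\int_{A_k}f(x)\,dx$ for $k\ge0$, one has $\sum_{k\ge0}(a_{k,q}(f))^{(d-q)/d}<\infty$. Then the minimum spanning tree problem is stable under small perturbations with perturbation blocks $\mathcal J_n=\{J_{n,i}:i\in[n]\}$, where $J_{n,i}=\{i\}$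 for all $i\in[n]$.
   Context: $[n]=\{1,\dots,n\}$; $E(G)$ is the edge set of $G$. The kissing number $\kappa(d)$ is the maximum number of non-overlapping unit spheres in $\mathbb R^d$ that can each touch a common unit sphere; it bounds the degrees of the Euclidean minimum spanning tree, so the minimizer over $\mathcal G_n$ is the minimum spanning tree over all trees. The metric on $\mathcal G_n$ is $d_n(G_1,G_2)=\frac1n\operatorname{card}(E(G_1)\,\Delta\,E(G_2))$. The minimizer is almost surely unique, denoted $\widehat T_n(\mathbf X^n)$. The input index set is $I_n=[n]$. Stability. $\mathcal J_n=\{J_{n,l}:l\in\mathcal L_n\}$ is a finite family of subsets of $I_n$ with union $I_n$; $m_n=\operatorname{card}(\mathcal L_n)$. For each $l$, $\mathbf X^{n,l}$ is an independent copy of $\mathbf X^n$ (no further assumption on the joint law over $l$), and $\mathbf X^n_l$ is $\mathbf X^n$ with the coordinates in $J_{n,l}$ replaced by those of $\mathbf X^{n,l}$. For a metric $\mathsf d$, $P(T,\mathsf d,\varepsilon)$ is the largest cardinality of a subset of $T$ with pairwise distances $>\varepsilon$. With $\mathcal O_{n,A}=\{\widehat T_n(\mathbf X^n_l):l\in A\}$, the sequence is stable under small perturbations with perturbation blocks $\mathcal J_n$ if for any $\varepsilon,\delta>0$ there is $M(\varepsilon,\delta)<\infty$ with $\limsup_{n\to\infty}\mathbb P[\min_{A\subseteq\mathcal L_n:|A|>(1-\varepsilon)m_n}P(\mathcal O_{n,A},d_n,\varepsilon)\ge M(\varepsilon,\delta)]\le\delta$. Sub-Gamma: an integrable real $X$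 is in $\mathscr G(\sigma^2,c)$ if $\log\mathbb E\exp[\lambda(X-\mathbb EX)]\le\lambda^2\sigma^2/(2(1-c|\lambda|))$ for all $|\lambda|<1/c$ (all $\lambda$ if $c=0$); $\mathscr G(\sigma^2,c;p)$ is the class of $p$-dimensional random vectors all of whose coordinates are in $\mathscr G(\sigma^2,c)$. Langevin assumption on $\mathcal P$ for the pair $(\rho,g)$: there is $p\in\mathbb N$ with $\rho:\mathbb R^p\to\mathbb R$, $g:\mathbb R^p\to\mathbb R^d$ such that (1) $\exp(-\rho)$ is integrable on $\mathbb R^p$; (2) $\rho$ is Lebesgue-almost everywhere differentiable and $\nabla\rho$ is Lipschitz, or (2)$'$ $\rho$ is twice continuously differentiable and $\|\nabla\rho\|_2^2-\frac12\Delta\rho$ is bounded below ($\Delta$ here the Laplacian), or (2)$''$ $\rho$ is twice continuously differentiable and there are $a,b\in\mathbb R$ with $x\cdot\nabla\rho(x)\ge-a\|x\|_2^2-b$ for all $x$ (any one suffices); (3) if $Y$ has density proportional to $\exp(-\rho)$, then $\nabla\rho(Y)\in\mathscr G(\sigma^2,c;p)$ for some $\sigma^2>0$, $c\ge0$; (4) $g$ has uniformly bounded first and second order derivatives and $g(Y)\sim\mathcal P$ for $Y$ as in (3). $\nabla g$ is the $d\times p$ Jacobian matrix. Rejection assumption: for $X\sim\mathcal P$ and $W\sim N_d(\mathbf 0,I_d)$ independent and any $r,s\ge0$, $\mathbb E\bigl[\|W\|_2^r\bigl(1-f(X+sW)/f(X)\bigr)_+\bigr]\le C(f,r)\,s$,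 with $C(f,r)$ a finite positive constant depending only on $f$ and $r$. *)

theory Defs
  imports "HOL-Probability.Probability"
begin

section \<open>The kissing number\<close>

text \<open>
  A configuration is given by the centres of the unit spheres touching the unit sphere around the
  origin. Spheres do not overlap if the open balls they bound are disjoint.
\<close>

definition kissing_configuration :: "'a::euclidean_space set \<Rightarrow> bool" where
  "kissing_configuration C \<longleftrightarrow>
     0 \<notin> C \<and>
     pairwise (\<lambda>a b. ball a 1 \<inter> ball b 1 = {}) (insert 0 C) \<and>
     (\<forall>c\<in>C. sphere c 1 \<inter> sphere 0 1 \<noteq> {})"

definition kissing_number :: "'a::euclidean_space itself \<Rightarrow> nat" where
  "kissing_number _ = Max {card C | C :: 'a set. finite C \<and> kissing_configuration C}"

section \<open>Trees and the minimum spanning tree problem\<close>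

text \<open>
  A finite simple graph on a fixed vertex set \<open>V\<close> is identified with its edge set, a set of
  two-element subsets of \<open>V\<close>.
\<close>

definition simple_graph_on :: "'v set \<Rightarrow> 'v set set \<Rightarrow> bool" where
  "simple_graph_on V E \<longleftrightarrow> (\<forall>e\<in>E. e \<subseteq> V \<and> card e = 2)"

definition connected_graph_on :: "'v set \<Rightarrow> 'v set set \<Rightarrow> bool" where
  "connected_graph_on V E \<longleftrightarrow>
     V \<noteq> {} \<and> (\<forall>u\<in>V. \<forall>v\<in>V. (u, v) \<in> {(a, b). {a, b} \<in> E}\<^sup>*)"

definition graph_cycle :: "'v set set \<Rightarrow> 'v list \<Rightarrow> bool" where
  "graph_cycle E c \<longleftrightarrow>
     3 \<le> length c \<and> distinct c \<and>
     (\<forall>i<length c. {c ! i, c ! (Suc i mod length c)} \<in> E)"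

definition tree_on :: "'v set \<Rightarrow> 'v set set \<Rightarrow> bool" where
  "tree_on V E \<longleftrightarrow>
     simple_graph_on V E \<and> connected_graph_on V E \<and> (\<nexists>c. graph_cycle E c)"

definition vertex_degree :: "'v set set \<Rightarrow> 'v \<Rightarrow> nat" where
  "vertex_degree E v = card {e \<in> E. v \<in> e}"

definition bounded_degree_trees :: "nat \<Rightarrow> nat \<Rightarrow> nat set set set" where
  "bounded_degree_trees k n =
     {E. tree_on {1..n} E \<and> (\<forall>v\<in>{1..n}. vertex_degree E v \<le> k)}"

text \<open>Each edge is counted once, through its ordered pair of endpoints \<open>i < j\<close>.\<close>

definition tree_cost :: "real \<Rightarrow> (nat \<Rightarrow> 'a::real_normed_vector) \<Rightarrow> nat set set \<Rightarrow> real" where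
  "tree_cost q x E = (\<Sum>(i, j) \<in> {(i, j). i < j \<and> {i, j} \<in> E}. norm (x i - x j) powr q)"

definition mst_class :: "'a::euclidean_space itself \<Rightarrow> nat \<Rightarrow> nat set set set" where
  "mst_class t n = bounded_degree_trees (kissing_number t) n"

text \<open>
  The minimizer is almost surely unique; on the null set of ties it is chosen as a function of the
  finite set of minimizers only, so that it is measurable in the input points.
\<close>

definition mst_minimizer :: "real \<Rightarrow> nat \<Rightarrow> (nat \<Rightarrow> 'a::euclidean_space) \<Rightarrow> nat set set" where
  "mst_minimizer q n x = arg_min_on (tree_cost q x) (mst_class TYPE('a) n)"

definition edge_dist :: "nat \<Rightarrow> nat set set \<Rightarrow> nat set set \<Rightarrow> real" where
  "edge_dist n E F = real (card (sym_diff E F)) / real n"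

section \<open>Inputs, independent copies and stability under small perturbations\<close>

definition iid_sample ::
  "'w measure \<Rightarrow> 'i set \<Rightarrow> ('w \<Rightarrow> 'i \<Rightarrow> 'a::topological_space) \<Rightarrow> 'a measure \<Rightarrow> bool" where
  "iid_sample M I X P \<longleftrightarrow>
     X \<in> M \<rightarrow>\<^sub>M PiM I (\<lambda>_. borel) \<and>
     prob_space.indep_vars M (\<lambda>_. borel) (\<lambda>i \<omega>. X \<omega> i) I \<and>
     (\<forall>i\<in>I. distr M borel (\<lambda>\<omega>. X \<omega> i) = P)"

definition independent_copy :: "'w measure \<Rightarrow> 'b measure \<Rightarrow> ('w \<Rightarrow> 'b) \<Rightarrow> ('w \<Rightarrow> 'b) \<Rightarrow> bool" where
  "independent_copy M N X X' \<longleftrightarrow>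
     prob_space.indep_var M N X N X' \<and> distr M N X' = distr M N X"

definition perturbation_blocks :: "'i set \<Rightarrow> 'l set \<Rightarrow> ('l \<Rightarrow> 'i set) \<Rightarrow> bool" where
  "perturbation_blocks I L J \<longleftrightarrow> finite L \<and> (\<Union>l\<in>L. J l) = I"

text \<open>The maximum is meant for finite \<open>T\<close>, the only case used below.\<close>

definition packing_number :: "'g set \<Rightarrow> ('g \<Rightarrow> 'g \<Rightarrow> real) \<Rightarrow> real \<Rightarrow> nat" where
  "packing_number T d \<epsilon> = Max {card S | S. S \<subseteq> T \<and> finite S \<and> pairwise (\<lambda>x y. d x y > \<epsilon>) S}"

text \<open>
  \<open>I n\<close> is the input index set, \<open>X n\<close> the input, \<open>X' n l\<close> its independent copies, \<open>T n\<close> the map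
  taking an input to the minimizer, \<open>d n\<close> the metric on outputs and \<open>J n l\<close>, for \<open>l \<in> L n\<close>, the blocks.
  \<open>override_on x y A\<close> agrees with \<open>y\<close> on \<open>A\<close> and with \<open>x\<close> elsewhere.
\<close>

definition stable_under_small_perturbations ::
  "(nat \<Rightarrow> 'w measure) \<Rightarrow> (nat \<Rightarrow> 'i set) \<Rightarrow> (nat \<Rightarrow> 'w \<Rightarrow> 'i \<Rightarrow> 'a) \<Rightarrow> (nat \<Rightarrow> 'l \<Rightarrow> 'w \<Rightarrow> 'i \<Rightarrow> 'a) \<Rightarrow>
   (nat \<Rightarrow> ('i \<Rightarrow> 'a) \<Rightarrow> 'g) \<Rightarrow> (nat \<Rightarrow> 'g \<Rightarrow> 'g \<Rightarrow> real) \<Rightarrow>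
   (nat \<Rightarrow> 'l set) \<Rightarrow> (nat \<Rightarrow> 'l \<Rightarrow> 'i set) \<Rightarrow> bool" where
  "stable_under_small_perturbations M I X X' T d L J \<longleftrightarrow>
     (\<forall>n. perturbation_blocks (I n) (L n) (J n)) \<and>
     (\<forall>\<epsilon>>0. \<forall>\<delta>>0. \<exists>m::real.
        limsup (\<lambda>n. ereal (measure (M n)
          {\<omega> \<in> space (M n).
             real (Min {packing_number ((\<lambda>l. T n (override_on (X n \<omega>) (X' n l \<omega>) (J n l))) ` A) (d n) \<epsilon>
                        | A. A \<subseteq> L n \<and> real (card A) > (1 - \<epsilon>) * real (card (L n))}) \<ge> m}))
        \<le> ereal \<delta>)"

section \<open>Gradient, Hessian, Laplacian\<close>

definition grad :: "('a::real_inner \<Rightarrow> real) \<Rightarrow> 'a \<Rightarrow> 'a" where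
  "grad f x = (THE D. GDERIV f x :> D)"

definition hessian :: "(real ^ 'p \<Rightarrow> real) \<Rightarrow> real ^ 'p \<Rightarrow> real ^ 'p ^ 'p" where
  "hessian f x = jacobian (grad f) (at x)"

definition laplacian :: "(real ^ 'p \<Rightarrow> real) \<Rightarrow> real ^ 'p \<Rightarrow> real" where
  "laplacian f x = trace (hessian f x)"

definition twice_differentiable :: "(real ^ 'p \<Rightarrow> real) \<Rightarrow> bool" where
  "twice_differentiable f \<longleftrightarrow>
     (\<forall>x. f differentiable (at x)) \<and> (\<forall>x. grad f differentiable (at x))"

definition twice_cont_differentiable :: "(real ^ 'p \<Rightarrow> real) \<Rightarrow> bool" where
  "twice_cont_differentiable f \<longleftrightarrow> twice_differentiable f \<and> continuous_on UNIV (hessian f)"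

section \<open>The assumptions on the sampling distribution\<close>

text \<open>
  The exponential moment is required to be finite explicitly, since the Bochner integral of a
  non-integrable function is 0.
\<close>

definition sub_gamma :: "'w measure \<Rightarrow> ('w \<Rightarrow> real) \<Rightarrow> real \<Rightarrow> real \<Rightarrow> bool" where
  "sub_gamma M X v c \<longleftrightarrow>
     integrable M X \<and>
     (\<forall>t::real. c = 0 \<or> \<bar>t\<bar> < 1 / c \<longrightarrow>
        integrable M (\<lambda>\<omega>. exp (t * (X \<omega> - integral\<^sup>L M X))) \<and>
        ln (\<integral>\<omega>. exp (t * (X \<omega> - integral\<^sup>L M X)) \<partial>M) \<le> t\<^sup>2 * v / (2 * (1 - c * \<bar>t\<bar>)))"

definition sub_gamma_vec :: "'w measure \<Rightarrow> ('w \<Rightarrow> real ^ 'p) \<Rightarrow> real \<Rightarrow> real \<Rightarrow> bool" where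
  "sub_gamma_vec M X v c \<longleftrightarrow> (\<forall>i. sub_gamma M (\<lambda>\<omega>. X \<omega> $ i) v c)"

text \<open>
  Lebesgue (rather than Borel) measurability of \<open>\<rho>\<close> is used, as \<open>\<rho>\<close> may be regular only almost
  everywhere.
\<close>

definition gibbs_measure :: "(real ^ 'p \<Rightarrow> real) \<Rightarrow> (real ^ 'p) measure" where
  "gibbs_measure \<rho> =
     density lebesgue (\<lambda>y. ennreal (exp (- \<rho> y) / (\<integral>z. exp (- \<rho> z) \<partial>lebesgue)))"

definition langevin_assumption ::
  "(real ^ 'd) measure \<Rightarrow> (real ^ 'p \<Rightarrow> real) \<Rightarrow> (real ^ 'p \<Rightarrow> real ^ 'd) \<Rightarrow> bool" where
  "langevin_assumption P \<rho> g \<longleftrightarrow>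
     integrable lebesgue (\<lambda>y. exp (- \<rho> y)) \<and>
     (((AE y in lebesgue. \<rho> differentiable (at y)) \<and>
         (\<exists>K. K-lipschitz_on {y. \<rho> differentiable (at y)} (grad \<rho>)))
      \<or> (twice_cont_differentiable \<rho> \<and>
         (\<exists>b. \<forall>y. b \<le> (norm (grad \<rho> y))\<^sup>2 - laplacian \<rho> y / 2))
      \<or> (twice_cont_differentiable \<rho> \<and>
         (\<exists>a b. \<forall>y. y \<bullet> grad \<rho> y \<ge> - a * (norm y)\<^sup>2 - b))) \<and>
     (\<exists>v>0. \<exists>c\<ge>0. sub_gamma_vec (gibbs_measure \<rho>) (grad \<rho>) v c) \<and>
     (\<forall>k. twice_differentiable (\<lambda>y. g y $ k) \<and>
          bounded (range (grad (\<lambda>y. g y $ k))) \<and>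
          bounded (range (hessian (\<lambda>y. g y $ k)))) \<and>
     distr (gibbs_measure \<rho>) borel g = P"

definition std_gaussian :: "(real ^ 'd) measure" where
  "std_gaussian = density lborel (\<lambda>w. ennreal (\<Prod>i\<in>UNIV. std_normal_density (w $ i)))"

text \<open>
  The pair \<open>(X, W)\<close> has law \<open>P \<Otimes>\<^sub>M std_gaussian\<close>. The integrand is dominated by
  \<open>norm w powr r\<close>, hence integrable for Borel measurable \<open>f \<ge> 0\<close>.
\<close>

definition rejection_assumption :: "(real ^ 'd) measure \<Rightarrow> (real ^ 'd \<Rightarrow> real) \<Rightarrow> bool" where
  "rejection_assumption P f \<longleftrightarrow>
     (\<forall>r\<ge>0. \<exists>C>0. \<forall>s\<ge>0.
        (\<integral>(x, w). norm w powr r * max 0 (1 - f (x + s *\<^sub>R w) / f x) \<partial>(P \<Otimes>\<^sub>M std_gaussian)) \<le> C * s)"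

definition shell :: "nat \<Rightarrow> 'a::real_normed_vector set" where
  "shell k = {x. 2 ^ k \<le> norm x \<and> norm x \<le> 2 ^ (k + 1)}"

definition shell_coeff :: "real \<Rightarrow> ('a::euclidean_space \<Rightarrow> real) \<Rightarrow> nat \<Rightarrow> real" where
  "shell_coeff q f k =
     2 powr (real k * real DIM('a) * q / (real DIM('a) - q)) * (LINT x:shell k|lborel. f x)"

end

theory Submission
  imports Defs
begin

text \<open>
  Almost surely all distances between the points are distinct. Then the minimum spanning tree consists
  of the pairs that are not joined by a path of strictly shorter edges. Two adjacent edges of it make
  an angle of at least 60 degrees, so its degrees are at most the kissing number \<open>k\<close> and it is also
  the minimizer over the trees of bounded degree. The edges of the tree that avoid a point \<open>l\<close> are
  edges of the minimum spanning tree of the remaining points; as trees on \<open>n\<close> points have \<open>n - 1\<close>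
  edges, deleting or inserting a point changes at most \<open>2 * k\<close> edges. Hence any two of the
  perturbed minimizers differ in at most \<open>8 * k\<close> edges, and for large \<open>n\<close> all packing numbers are 1.
\<close>

section \<open>Forests and spanning trees\<close>

text \<open>The minimizer is a choice among optimal trees, which is hard to compare at two inputs.
  \<open>mst_edges\<close> describes it without minimization: a pair is rejected exactly when
  strictly lighter pairs join its ends. Deleting a vertex removes pairs, so it can only destroy such
  joining paths and never causes the rejection of a surviving edge. This inclusion is one-sided; the
  edges that are new after the deletion are controlled by counting alone. The comparison is
  deterministic once distances are distinct at the unperturbed input and at each perturbed one.
  Every perturbed input has the law of the unperturbed one, and for given n there are only n + 1
  inputs, so finitely many null sets cover all exceptions, whatever the joint law of the copies. Two
  perturbed inputs may differ at two vertices and are therefore compared through the unperturbed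
  one, which doubles the bound 4 * k for a single replacement. The edge distance divides by n, while
  k depends on the dimension only.\<close>

definition adjacency :: "'v set set \<Rightarrow> ('v \<times> 'v) set" where
  "adjacency E = {(a, b). {a, b} \<in> E}"

text \<open>Every edge is a bridge. For simple graphs this is the absence of cycles, in a form that
  suits adding and deleting single edges.\<close>

definition forest :: "'v set set \<Rightarrow> bool" where
  "forest E \<longleftrightarrow> (\<forall>u v. {u, v} \<in> E \<longrightarrow> (u, v) \<notin> (adjacency (E - {{u, v}}))\<^sup>*)"

lemma adjacency_mono: "E \<subseteq> F \<Longrightarrow> adjacency E \<subseteq> adjacency F"
  by (auto simp: adjacency_def)

lemma reach_mono: "E \<subseteq> F \<Longrightarrow> (u, v) \<in> (adjacency E)\<^sup>* \<Longrightarrow> (u, v) \<in> (adjacency F)\<^sup>*"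
  by (rule subsetD[OF rtrancl_mono[OF adjacency_mono]])

lemma reach_edge: "{u, v} \<in> E \<Longrightarrow> (u, v) \<in> (adjacency E)\<^sup>*"
  by (rule r_into_rtrancl) (simp add: adjacency_def)

lemma reach_sym: "(u, v) \<in> (adjacency E)\<^sup>* \<Longrightarrow> (v, u) \<in> (adjacency E)\<^sup>*"
proof -
  have "sym (adjacency E)"
    by (auto simp: sym_def adjacency_def insert_commute)
  then show "(u, v) \<in> (adjacency E)\<^sup>* \<Longrightarrow> (v, u) \<in> (adjacency E)\<^sup>*"
    by (metis sym_rtrancl symD)
qed

text \<open>A walk can be shortened until it uses the new edge at most once, in one of its two
  directions.\<close>

lemma reach_insert:
  "(x, y) \<in> (adjacency (insert {a, b} E))\<^sup>* \<longleftrightarrow>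
     (x, y) \<in> (adjacency E)\<^sup>* \<or>
     (x, a) \<in> (adjacency E)\<^sup>* \<and> (b, y) \<in> (adjacency E)\<^sup>* \<or>
     (x, b) \<in> (adjacency E)\<^sup>* \<and> (a, y) \<in> (adjacency E)\<^sup>*"
proof -
  have "adjacency (insert {a, b} E) = insert (a, b) (insert (b, a) (adjacency E))"
    by (auto simp: adjacency_def doubleton_eq_iff)
  then show ?thesis
    using rtrancl_trans[of x a "adjacency E" y] rtrancl_trans[of x b "adjacency E" y]
    by (auto simp: rtrancl_insert)
qed

lemma reach_lift:
  assumes "(u, v) \<in> (adjacency E)\<^sup>*" "\<And>a b. {a, b} \<in> E \<Longrightarrow> (a, b) \<in> (adjacency F)\<^sup>*"
  shows "(u, v) \<in> (adjacency F)\<^sup>*"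
  using assms(1)
proof induction
  case (step y z)
  then have "(y, z) \<in> (adjacency F)\<^sup>*"
    using assms(2)[of y z] by (simp add: adjacency_def)
  with step.IH show ?case
    by (rule rtrancl_trans)
qed simp

lemma forest_empty: "forest {}"
  by (simp add: forest_def)

lemma forest_subset:
  assumes "forest E" "F \<subseteq> E"
  shows "forest F"
  unfolding forest_def
proof (intro allI impI notI)
  fix u v
  assume uv: "{u, v} \<in> F" and r: "(u, v) \<in> (adjacency (F - {{u, v}}))\<^sup>*"
  have uvE: "{u, v} \<in> E"
    by (rule subsetD[OF assms(2) uv])
  have "F - {{u, v}} \<subseteq> E - {{u, v}}"
    using assms(2) by (rule Diff_mono) (rule order_refl)
  then have "(u, v) \<in> (adjacency (E - {{u, v}}))\<^sup>*"
    using r by (rule reach_mono)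
  then show False
    using assms(1) uvE unfolding forest_def by simp
qed

text \<open>If the ends of another edge \<open>{x, y}\<close> stayed joined without it, the joining
  path would have to pass through \<open>{a, b}\<close>; closing it up by \<open>{x, y}\<close>
  would join \<open>a\<close> and \<open>b\<close> within \<open>E\<close>.\<close>

lemma forest_insert:
  assumes F: "forest E" and ab: "(a, b) \<notin> (adjacency E)\<^sup>*"
  shows "forest (insert {a, b} E)"
  unfolding forest_def
proof (intro allI impI notI)
  fix x y
  assume xy: "{x, y} \<in> insert {a, b} E"
    and r: "(x, y) \<in> (adjacency (insert {a, b} E - {{x, y}}))\<^sup>*"
  have abE: "{a, b} \<notin> E"
    using ab reach_edge[of a b E] by argo
  show False
  proof (cases "{x, y} = {a, b}")
    case True
    then have "(x, y) \<in> (adjacency E)\<^sup>*"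
      using r abE by simp
    with True ab show False
      using reach_sym[of x y E] by (auto simp: doubleton_eq_iff)
  next
    case False
    then have xyE: "{x, y} \<in> E" and eq: "insert {a, b} E - {{x, y}} = insert {a, b} (E - {{x, y}})"
      using xy by auto
    have nr: "(x, y) \<notin> (adjacency (E - {{x, y}}))\<^sup>*"
      using F xyE by (auto simp: forest_def)
    have sub: "(s, t) \<in> (adjacency E)\<^sup>*" if "(s, t) \<in> (adjacency (E - {{x, y}}))\<^sup>*" for s t
      using Diff_subset that by (rule reach_mono)
    from r nr consider "(x, a) \<in> (adjacency (E - {{x, y}}))\<^sup>*" "(b, y) \<in> (adjacency (E - {{x, y}}))\<^sup>*"
      | "(x, b) \<in> (adjacency (E - {{x, y}}))\<^sup>*" "(a, y) \<in> (adjacency (E - {{x, y}}))\<^sup>*"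
      unfolding eq reach_insert by blast
    then have "(a, b) \<in> (adjacency E)\<^sup>*"
    proof cases
      case 1
      then have "(a, x) \<in> (adjacency E)\<^sup>*" "(y, b) \<in> (adjacency E)\<^sup>*"
        using sub[THEN reach_sym] by blast+
      then show ?thesis
        using reach_edge[OF xyE] rtrancl_trans[of a x _ y] rtrancl_trans[of a y _ b] by auto
    next
      case 2
      then have "(a, y) \<in> (adjacency E)\<^sup>*" "(x, b) \<in> (adjacency E)\<^sup>*"
        using sub by blast+
      then show ?thesis
        using reach_edge[OF xyE, THEN reach_sym] rtrancl_trans[of a y _ x] rtrancl_trans[of a x _ b]
        by auto
    qed
    then show False
      using ab by blast
  qed
qed

section \<open>Counting connected components\<close>

definition component :: "'v set set \<Rightarrow> 'v \<Rightarrow> 'v set" where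
  "component E v = (adjacency E)\<^sup>* `` {v}"

lemma component_eq_iff: "component E u = component E v \<longleftrightarrow> (u, v) \<in> (adjacency E)\<^sup>*"
proof
  assume "component E u = component E v"
  then have "v \<in> component E u"
    by (simp add: component_def)
  then show "(u, v) \<in> (adjacency E)\<^sup>*"
    by (simp add: component_def)
next
  assume "(u, v) \<in> (adjacency E)\<^sup>*"
  then show "component E u = component E v"
    using reach_sym[of u v E] by (auto simp: component_def intro: rtrancl_trans)
qed

lemma mem_component_iff: "w \<in> component E v \<longleftrightarrow> component E v = component E w"
  unfolding component_eq_iff by (simp add: component_def)

text \<open>The components of \<open>a\<close> and \<open>b\<close> merge into their union and all
  others stay the same.\<close>

lemma card_components_insert:
  assumes V: "finite V" "a \<in> V" "b \<in> V" and ab: "(a, b) \<notin> (adjacency E)\<^sup>*"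
  shows "card (component E ` V) = Suc (card (component (insert {a, b} E) ` V))"
proof -
  let ?A = "component E a" and ?B = "component E b"
  have comp: "component (insert {a, b} E) v =
      (if component E v = ?A \<or> component E v = ?B then ?A \<union> ?B else component E v)" for v
  proof -
    have "w \<in> component (insert {a, b} E) v \<longleftrightarrow>
        component E v = component E w \<or> component E v = ?A \<and> ?B = component E w \<or>
        component E v = ?B \<and> ?A = component E w" for w
      unfolding component_eq_iff by (simp add: component_def reach_insert)
    then have "w \<in> component (insert {a, b} E) v \<longleftrightarrow>
        w \<in> (if component E v = ?A \<or> component E v = ?B then ?A \<union> ?B else component E v)" for w
      by (auto simp: mem_component_iff)
    then show ?thesis
      by blast
  qed
  have AB: "?A \<noteq> ?B"
    using ab by (simp add: component_eq_iff)
  have self: "v \<in> component E v" for v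
    by (simp add: component_def)
  have img: "component (insert {a, b} E) ` V = insert (?A \<union> ?B) (component E ` V - {?A, ?B})"
    using V unfolding comp by (auto simp: image_iff)
  \<comment> \<open>The union differs from every remaining component, so two components are traded
    for exactly one.\<close>
  have "?A \<union> ?B \<notin> component E ` V - {?A, ?B}"
  proof
    assume "?A \<union> ?B \<in> component E ` V - {?A, ?B}"
    then obtain v where v: "?A \<union> ?B = component E v" "component E v \<noteq> ?A"
      by auto
    then have "(v, a) \<in> (adjacency E)\<^sup>*"
      using self[of a] by (auto simp: component_def)
    with v show False
      by (metis component_eq_iff)
  qed
  moreover have "card {?A, ?B} = 2"
    using AB by simp
  moreover have "card (component E ` V - {?A, ?B}) = card (component E ` V) - card {?A, ?B}"
    using V by (intro card_Diff_subset) auto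
  moreover have "card {?A, ?B} \<le> card (component E ` V)"
    using V by (intro card_mono) auto
  ultimately show ?thesis
    using V unfolding img by simp
qed

text \<open>Starting from singletons, each edge of a forest joins two different components, because
  it is a bridge, and so lowers their number by one.\<close>

lemma card_components_forest:
  assumes V: "finite V" and "finite E" "simple_graph_on V E" "forest E"
  shows "card (component E ` V) + card E = card V"
  using assms(2-)
proof (induction E)
  case empty
  have "component {} v = {v}" for v :: 'a
    by (auto simp: component_def adjacency_def)
  then show ?case
    by (simp add: card_image inj_on_def)
next
  case (insert e E)
  obtain a b where e: "e = {a, b}" "a \<noteq> b" "a \<in> V" "b \<in> V"
    using insert.prems(1) by (auto simp: simple_graph_on_def card_2_iff)
  have "(a, b) \<notin> (adjacency E)\<^sup>*"
    using insert.prems(2) insert.hyps(2) e by (auto simp: forest_def)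
  moreover have "card (component E ` V) + card E = card V"
    using insert.prems by (intro insert.IH forest_subset[OF insert.prems(2)])
      (auto simp: simple_graph_on_def)
  ultimately show ?case
    using card_components_insert[OF V e(3,4)] insert.hyps by (simp add: e)
qed

lemma finite_simple_graph: "finite V \<Longrightarrow> simple_graph_on V E \<Longrightarrow> finite E"
  by (rule finite_subset[of _ "Pow V"]) (auto simp: simple_graph_on_def)

section \<open>Cycles and bridges\<close>

lemma simple_path_exists:
  assumes "(u, v) \<in> (adjacency E)\<^sup>*"
  shows "\<exists>p. p \<noteq> [] \<and> distinct p \<and> hd p = u \<and> last p = v \<and>
    (\<forall>i. Suc i < length p \<longrightarrow> {p ! i, p ! Suc i} \<in> E)"
  using assms
proof induction
  case base
  show ?case
    by (rule exI[of _ "[u]"]) simp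
next
  case (step y z)
  then obtain p where p: "p \<noteq> []" "distinct p" "hd p = u" "last p = y"
    "\<And>i. Suc i < length p \<Longrightarrow> {p ! i, p ! Suc i} \<in> E"
    by blast
  show ?case
  proof (cases "z \<in> set p")
    case True
    then obtain i where i: "i < length p" "p ! i = z"
      by (auto simp: in_set_conv_nth)
    \<comment> \<open>A repetition of \<open>z\<close> is avoided by cutting the path at its earlier
      occurrence.\<close>
    have "last (take (Suc i) p) = z"
      using i by (simp add: take_Suc_conv_app_nth)
    then show ?thesis
      using p by (intro exI[of _ "take (Suc i) p"]) auto
  next
    case False
    have "{(p @ [z]) ! i, (p @ [z]) ! Suc i} \<in> E" if "Suc i < length (p @ [z])" for i
    proof (cases "Suc i < length p")
      case True
      then show ?thesis
        using p(5)[of i] by (simp add: nth_append)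
    next
      case F: False
      then have "i = length p - 1" "Suc i = length p"
        using that p(1) by auto
      then have "(p @ [z]) ! i = y" "(p @ [z]) ! Suc i = z"
        using p(1,4) by (auto simp: nth_append last_conv_nth)
      then show ?thesis
        using step.hyps(2) by (simp add: adjacency_def)
    qed
    with p False show ?thesis
      by (intro exI[of _ "p @ [z]"]) simp
  qed
qed

text \<open>A simple path that joins the ends of an edge without using it closes up to a cycle;
  conversely, a cycle without its closing edge still joins the ends of that edge.\<close>

lemma tree_on_iff:
  "tree_on V E \<longleftrightarrow>
     simple_graph_on V E \<and> V \<noteq> {} \<and> (\<forall>u\<in>V. \<forall>v\<in>V. (u, v) \<in> (adjacency E)\<^sup>*) \<and> forest E"
proof -
  have "(\<nexists>c. graph_cycle E c) \<longleftrightarrow> forest E" if simple: "simple_graph_on V E"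
  proof
    assume nc: "\<nexists>c. graph_cycle E c"
    show "forest E"
      unfolding forest_def
    proof (intro allI impI notI)
      fix u v
      assume uv: "{u, v} \<in> E" and r: "(u, v) \<in> (adjacency (E - {{u, v}}))\<^sup>*"
      from simple_path_exists[OF r] obtain p where p: "p \<noteq> []" "distinct p" "hd p = u" "last p = v"
        "\<And>i. Suc i < length p \<Longrightarrow> {p ! i, p ! Suc i} \<in> E - {{u, v}}"
        by blast
      have "card {u, v} = 2"
        using simple uv by (auto simp: simple_graph_on_def)
      then have "u \<noteq> v"
        by auto
      have ends: "p ! 0 = u" "p ! (length p - 1) = v"
        using p by (auto simp: hd_conv_nth last_conv_nth)
      have "length p \<noteq> 1" "length p \<noteq> 0"
        using ends \<open>u \<noteq> v\<close> p(1) by auto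
      \<comment> \<open>A path with two vertices would consist of the deleted edge itself.\<close>
      moreover have "length p \<noteq> 2"
        using ends p(5)[of 0] by auto
      ultimately have "3 \<le> length p"
        by linarith
      moreover have "{p ! i, p ! (Suc i mod length p)} \<in> E" if "i < length p" for i
      proof (cases "Suc i < length p")
        case True
        then show ?thesis
          using p(5)[of i] by simp
      next
        case False
        then have "Suc i = length p"
          using that by simp
        then have "i = length p - 1" "Suc i mod length p = 0"
          by auto
        then show ?thesis
          using ends uv by (simp add: insert_commute)
      qed
      ultimately have "graph_cycle E p"
        using p(2) by (auto simp: graph_cycle_def)
      with nc show False
        by blast
    qed
  next
    assume f: "forest E"
    show "\<nexists>c. graph_cycle E c"
    proof
      assume "\<exists>c. graph_cycle E c"
      then obtain c where c: "3 \<le> length c" "distinct c"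
        "\<And>i. i < length c \<Longrightarrow> {c ! i, c ! (Suc i mod length c)} \<in> E"
        by (auto simp: graph_cycle_def)
      let ?m = "length c - 1"
      have m: "Suc ?m = length c" "0 < length c" "?m < length c" "0 < ?m"
        using c(1) by linarith+
      let ?e = "{c ! 0, c ! ?m}"
      have e: "?e \<in> E"
        using c(3)[of ?m] m by (simp add: insert_commute)
      have "i \<le> ?m \<Longrightarrow> (c ! 0, c ! i) \<in> (adjacency (E - {?e}))\<^sup>*" for i
      proof (induction i)
        case (Suc i)
        then have i: "Suc i < length c"
          using m by linarith
        \<comment> \<open>Distinctness turns equal edges into equal index pairs, and a length of at
          least 3 rules out that \<open>0\<close> and \<open>?m\<close> are consecutive.\<close>
        have "{c ! i, c ! Suc i} \<noteq> ?e"
        proof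
          assume "{c ! i, c ! Suc i} = ?e"
          then have "c ! i = c ! 0 \<and> c ! Suc i = c ! ?m \<or> c ! i = c ! ?m \<and> c ! Suc i = c ! 0"
            by (simp only: doubleton_eq_iff)
          then have "i = 0 \<and> Suc i = ?m \<or> i = ?m \<and> Suc i = 0"
            using i m(2,3) nth_eq_iff_index_eq[OF c(2), of i 0] nth_eq_iff_index_eq[OF c(2), of i ?m]
              nth_eq_iff_index_eq[OF c(2), of "Suc i" ?m] nth_eq_iff_index_eq[OF c(2), of "Suc i" 0]
            by linarith
          then show False
            using c(1) by auto
        qed
        moreover have "{c ! i, c ! Suc i} \<in> E"
          using c(3)[of i] i by simp
        ultimately have "(c ! i, c ! Suc i) \<in> (adjacency (E - {?e}))\<^sup>*"
          by (intro reach_edge) simp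
        moreover have "(c ! 0, c ! i) \<in> (adjacency (E - {?e}))\<^sup>*"
          using Suc by simp
        ultimately show ?case
          by (rule rtrancl_trans[rotated])
      qed simp
      from this[of ?m] f e show False
        by (auto simp: forest_def)
    qed
  qed
  then show ?thesis
    by (auto simp: tree_on_def connected_graph_on_def adjacency_def)
qed

lemma card_tree:
  assumes "finite V" "tree_on V E"
  shows "Suc (card E) = card V"
proof -
  obtain r where r: "r \<in> V"
    using assms(2) by (auto simp: tree_on_iff)
  have "component E x = component E r" if "x \<in> V" for x
    using assms(2) r that by (simp add: tree_on_iff component_eq_iff)
  then have "component E ` V = {component E r}"
    using r by blast
  moreover have "simple_graph_on V E" "forest E"
    using assms(2) by (auto simp: tree_on_iff)
  ultimately show ?thesis
    using card_components_forest[OF assms(1) finite_simple_graph[OF assms(1)], of E] by simp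
qed

text \<open>The path in the tree from \<open>a\<close> to \<open>b\<close> must use
  \<open>{u, v}\<close>; the rest of it together with the new edge joins \<open>u\<close> and
  \<open>v\<close> again.\<close>

lemma tree_exchange:
  assumes T: "tree_on V E" and uv: "{u, v} \<in> E" and ab: "a \<in> V" "b \<in> V"
    and nr: "(a, b) \<notin> (adjacency (E - {{u, v}}))\<^sup>*"
  shows "tree_on V (insert {a, b} (E - {{u, v}}))"
proof -
  let ?E = "E - {{u, v}}"
  have T': "simple_graph_on V E" "V \<noteq> {}" "\<And>x y. x \<in> V \<Longrightarrow> y \<in> V \<Longrightarrow> (x, y) \<in> (adjacency E)\<^sup>*" "forest E"
    using T by (auto simp: tree_on_iff)
  have E: "E = insert {u, v} ?E"
    using uv by auto
  have "(a, b) \<in> (adjacency (insert {u, v} ?E))\<^sup>*"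
    using T'(3)[OF ab] E by simp
  with nr have "(a, u) \<in> (adjacency ?E)\<^sup>* \<and> (v, b) \<in> (adjacency ?E)\<^sup>* \<or>
      (a, v) \<in> (adjacency ?E)\<^sup>* \<and> (u, b) \<in> (adjacency ?E)\<^sup>*"
    unfolding reach_insert by blast
  then have uv': "(u, v) \<in> (adjacency (insert {a, b} ?E))\<^sup>*"
    unfolding reach_insert by (meson reach_sym)
  have "(x, y) \<in> (adjacency (insert {a, b} ?E))\<^sup>*" if "{x, y} \<in> E" for x y
  proof (cases "{x, y} = {u, v}")
    case True
    then show ?thesis
      using uv' by (metis doubleton_eq_iff reach_sym)
  next
    case False
    then show ?thesis
      using that by (intro reach_edge) auto
  qed
  then have "(x, y) \<in> (adjacency (insert {a, b} ?E))\<^sup>*" if "x \<in> V" "y \<in> V" for x y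
    using T'(3)[OF that] by (rule reach_lift[rotated])
  moreover have "a \<noteq> b"
    using nr by auto
  then have "simple_graph_on V (insert {a, b} ?E)"
    using T'(1) ab by (auto simp: simple_graph_on_def)
  moreover have "forest (insert {a, b} ?E)"
    using T'(4) nr by (intro forest_insert) (auto intro: forest_subset)
  ultimately show ?thesis
    using T'(2) by (auto simp: tree_on_iff)
qed

section \<open>The minimum spanning tree for distinct weights\<close>

definition pairs_in :: "'v set \<Rightarrow> 'v set set" where
  "pairs_in V = {e. e \<subseteq> V \<and> card e = 2}"

definition lighter_pairs :: "'v set \<Rightarrow> ('v set \<Rightarrow> real) \<Rightarrow> real \<Rightarrow> 'v set set" where
  "lighter_pairs V c t = {e \<in> pairs_in V. c e < t}"

text \<open>The cycle property taken as a definition, so that it applies to all vertex sets and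
  weights at once. Quantifying over both orders of the ends avoids choosing one.\<close>

definition mst_edges :: "'v set \<Rightarrow> ('v set \<Rightarrow> real) \<Rightarrow> 'v set set" where
  "mst_edges V c =
     {e \<in> pairs_in V. \<forall>u v. e = {u, v} \<longrightarrow> (u, v) \<notin> (adjacency (lighter_pairs V c (c e)))\<^sup>*}"

lemma finite_pairs_in: "finite V \<Longrightarrow> finite (pairs_in V)"
  by (rule finite_subset[of _ "Pow V"]) (auto simp: pairs_in_def)

lemma mem_pairs_inD: "{u, v} \<in> pairs_in V \<Longrightarrow> u \<in> V \<and> v \<in> V \<and> u \<noteq> v"
  by (auto simp: pairs_in_def card_insert_if)

lemma pairs_inE:
  assumes "e \<in> pairs_in V"
  obtains u v where "e = {u, v}" "u \<in> V" "v \<in> V" "u \<noteq> v"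
  using assms by (auto simp: pairs_in_def card_2_iff)

lemma simple_graph_on_iff: "simple_graph_on V E \<longleftrightarrow> E \<subseteq> pairs_in V"
  by (auto simp: simple_graph_on_def pairs_in_def)

lemma mst_edges_subset: "mst_edges V c \<subseteq> pairs_in V"
  by (auto simp: mst_edges_def)

text \<open>Fewer vertices leave fewer lighter pairs, so ends that these did not join remain
  unjoined.\<close>

lemma mst_edges_restrict: "V' \<subseteq> V \<Longrightarrow> mst_edges V c \<inter> pairs_in V' \<subseteq> mst_edges V' c"
proof
  fix e
  assume "V' \<subseteq> V" and e: "e \<in> mst_edges V c \<inter> pairs_in V'"
  then have "lighter_pairs V' c (c e) \<subseteq> lighter_pairs V c (c e)"
    by (auto simp: lighter_pairs_def pairs_in_def)
  from reach_mono[OF this] e show "e \<in> mst_edges V' c"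
    by (simp add: mst_edges_def) metis
qed

lemma mst_edges_cong:
  assumes "\<And>e. e \<in> pairs_in V \<Longrightarrow> c e = c' e"
  shows "mst_edges V c = mst_edges V c'"
proof -
  have "lighter_pairs V c t = lighter_pairs V c' t" for t
    using assms by (auto simp: lighter_pairs_def)
  then show ?thesis
    unfolding mst_edges_def by (intro Collect_cong conj_cong refl) (simp only: assms)
qed

text \<open>Kruskal's order: adding the edges by increasing weight never closes a cycle.\<close>

lemma forest_mst_edges:
  assumes V: "finite V" and inj: "inj_on c (pairs_in V)"
  shows "forest (mst_edges V c)"
proof -
  have "S \<subseteq> mst_edges V c \<longrightarrow> forest S" if "finite S" for S
    using that
  proof (induction rule: finite_ranking_induct[where f = c])
    case empty
    then show ?case
      by (simp add: forest_empty)
  next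
    case (insert e S)
    show ?case
    proof (cases "e \<in> S")
      case True
      then show ?thesis
        using insert by (simp add: insert_absorb)
    next
      case False
      show ?thesis
      proof
        assume sub: "insert e S \<subseteq> mst_edges V c"
        then have e: "e \<in> mst_edges V c" and S: "S \<subseteq> pairs_in V"
          using mst_edges_subset by auto
        then obtain u v where uv: "e = {u, v}"
          using mst_edges_subset by (metis pairs_inE subsetD)
        \<comment> \<open>The ranking makes \<open>e\<close> at least as heavy as all of
          \<open>S\<close>; injectivity of the weights makes it strictly heavier.\<close>
        have "S \<subseteq> lighter_pairs V c (c e)"
        proof
          fix g
          assume g: "g \<in> S"
          then have "c g \<noteq> c e"
            using False S e mst_edges_subset inj by (metis inj_onD subsetD)
          then show "g \<in> lighter_pairs V c (c e)"
            using insert.hyps(2)[OF g] S g by (auto simp: lighter_pairs_def)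
        qed
        moreover have "(u, v) \<notin> (adjacency (lighter_pairs V c (c e)))\<^sup>*"
          using e uv by (auto simp: mst_edges_def)
        ultimately have "(u, v) \<notin> (adjacency S)\<^sup>*"
          using reach_mono[of S _ u v] by metis
        then show "forest (insert e S)"
          using insert.IH sub unfolding uv by (intro forest_insert) auto
      qed
    qed
  qed
  then show ?thesis
    using finite_subset[OF mst_edges_subset finite_pairs_in[OF V]] by blast
qed

text \<open>A lightest pair not joined within \<open>mst_edges\<close> would itself be rejected, so
  strictly lighter pairs would join its ends; by minimality each of these is joined within
  \<open>mst_edges\<close>.\<close>

lemma mst_edges_connected:
  assumes V: "finite V" and uv: "u \<in> V" "v \<in> V"
  shows "(u, v) \<in> (adjacency (mst_edges V c))\<^sup>*"
proof (rule ccontr)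
  let ?K = "mst_edges V c"
  let ?B = "{e \<in> pairs_in V. \<exists>a b. e = {a, b} \<and> (a, b) \<notin> (adjacency ?K)\<^sup>*}"
  assume nr: "(u, v) \<notin> (adjacency ?K)\<^sup>*"
  then have "u \<noteq> v"
    by auto
  with nr uv have "{u, v} \<in> ?B"
    by (auto simp: pairs_in_def)
  moreover have "finite ?B"
    using finite_pairs_in[OF V] by simp
  ultimately obtain e where e: "e \<in> ?B" and least: "\<And>g. g \<in> ?B \<Longrightarrow> c e \<le> c g"
    using arg_min_if_finite(1)[of ?B c] arg_min_least[of ?B _ c] by blast
  then obtain a b where ab: "e = {a, b}" "(a, b) \<notin> (adjacency ?K)\<^sup>*" "e \<in> pairs_in V"
    by blast
  then have "e \<notin> ?K"
    using reach_edge[of a b ?K] by metis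
  then obtain s t where st: "e = {s, t}" "(s, t) \<in> (adjacency (lighter_pairs V c (c e)))\<^sup>*"
    using ab by (auto simp: mst_edges_def)
  have "(x, y) \<in> (adjacency ?K)\<^sup>*" if "{x, y} \<in> lighter_pairs V c (c e)" for x y
    using least[of "{x, y}"] that by (force simp: lighter_pairs_def)
  with st(2) have "(s, t) \<in> (adjacency ?K)\<^sup>*"
    by (rule reach_lift)
  then show False
    using ab(1,2) st(1) by (metis doubleton_eq_iff reach_sym)
qed

lemma tree_mst_edges:
  assumes "finite V" "V \<noteq> {}" "inj_on c (pairs_in V)"
  shows "tree_on V (mst_edges V c)"
  using assms by (simp add: tree_on_iff simple_graph_on_iff forest_mst_edges mst_edges_connected
      mst_edges_subset)

text \<open>An edge outside \<open>mst_edges\<close> could be exchanged for a strictly lighter one.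
  The reverse inclusion holds because a connected spanning part of a forest is the whole
  forest.\<close>

lemma minimal_tree_eq_mst_edges:
  assumes V: "finite V" and inj: "inj_on c (pairs_in V)" and T: "tree_on V E"
    and least: "\<And>F. tree_on V F \<Longrightarrow> sum c E \<le> sum c F"
  shows "E = mst_edges V c"
proof
  have simple: "E \<subseteq> pairs_in V"
    using T by (simp add: tree_on_iff simple_graph_on_iff)
  have fin: "finite E"
    using simple V finite_pairs_in finite_subset by blast
  show sub: "E \<subseteq> mst_edges V c"
  proof
    fix e
    assume e: "e \<in> E"
    show "e \<in> mst_edges V c"
    proof (rule ccontr)
      assume "e \<notin> mst_edges V c"
      then obtain u v where uv: "e = {u, v}" "(u, v) \<in> (adjacency (lighter_pairs V c (c e)))\<^sup>*"
        using e simple by (auto simp: mst_edges_def)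
      have "(u, v) \<notin> (adjacency (E - {{u, v}}))\<^sup>*"
        using T e uv by (auto simp: tree_on_iff forest_def)
      \<comment> \<open>Removing \<open>e\<close> separates its ends, so the path of lighter pairs
        between them has a step that crosses the cut.\<close>
      then obtain a b where ab: "{a, b} \<in> lighter_pairs V c (c e)"
        "(a, b) \<notin> (adjacency (E - {{u, v}}))\<^sup>*"
        using reach_lift[OF uv(2), of "E - {{u, v}}"] by metis
      then have ab': "a \<in> V" "b \<in> V" "c {a, b} < c e" "{a, b} \<notin> E - {{u, v}}"
        using reach_edge[of a b "E - {{u, v}}"] by (auto simp: lighter_pairs_def dest: mem_pairs_inD)
      have "sum c E \<le> sum c (insert {a, b} (E - {{u, v}}))"
        using T e uv ab(2) ab'(1,2) by (intro least tree_exchange) auto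
      also have "\<dots> = c {a, b} + (sum c E - c e)"
        using ab'(4) fin e uv(1) by (simp add: sum_diff1)
      finally show False
        using ab'(3) by simp
    qed
  qed
  show "mst_edges V c \<subseteq> E"
  proof
    fix e
    assume e: "e \<in> mst_edges V c"
    then obtain u v where uv: "e = {u, v}" "u \<in> V" "v \<in> V"
      using mst_edges_subset by (metis pairs_inE subsetD)
    show "e \<in> E"
    proof (rule ccontr)
      assume "e \<notin> E"
      then have "E \<subseteq> mst_edges V c - {{u, v}}"
        using sub uv by auto
      moreover have "(u, v) \<in> (adjacency E)\<^sup>*"
        using T uv by (simp add: tree_on_iff)
      ultimately have "(u, v) \<in> (adjacency (mst_edges V c - {{u, v}}))\<^sup>*"
        by (rule reach_mono)
      then show False
        using forest_mst_edges[OF V inj] e uv by (auto simp: forest_def)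
    qed
  qed
qed

text \<open>Comparing \<open>E\<close> with one tree suffices, since a minimizer over the finitely
  many trees exists and equals \<open>mst_edges V c\<close>. In the application, \<open>E\<close> is
  known to be optimal only among trees of bounded degree.\<close>

lemma mst_edges_unique_minimizer:
  assumes V: "finite V" "V \<noteq> {}" and inj: "inj_on c (pairs_in V)" and T: "tree_on V E"
    and le: "sum c E \<le> sum c (mst_edges V c)"
  shows "E = mst_edges V c"
proof -
  let ?T = "{F. tree_on V F}"
  have "finite ?T"
    by (rule finite_subset[of _ "Pow (pairs_in V)"])
      (auto simp: tree_on_iff simple_graph_on_iff finite_pairs_in V)
  moreover have "mst_edges V c \<in> ?T"
    using tree_mst_edges[OF V inj] by simp
  ultimately obtain F where F: "tree_on V F" and least: "\<And>G. tree_on V G \<Longrightarrow> sum c F \<le> sum c G"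
    using arg_min_if_finite(1)[of ?T "sum c"] arg_min_least[of ?T _ "sum c"] by blast
  have "F = mst_edges V c"
    by (rule minimal_tree_eq_mst_edges[OF V(1) inj F least])
  with le least show ?thesis
    by (intro minimal_tree_eq_mst_edges[OF V(1) inj T]) force
qed

text \<open>The strictly heaviest side of a triangle is never chosen, as the other two sides join
  its ends. Were \<open>{u, w}\<close> lighter than \<open>{u, v}\<close>, the heavier of the two
  chosen sides would be such a side.\<close>

lemma mst_edges_adjacent_le:
  assumes inj: "inj_on c (pairs_in V)" and e: "{u, v} \<in> mst_edges V c" "{w, v} \<in> mst_edges V c"
    and uw: "u \<noteq> w"
  shows "c {u, v} \<le> c {u, w}"
proof (rule ccontr)
  assume "\<not> c {u, v} \<le> c {u, w}"
  then have less: "c {u, w} < c {u, v}"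
    by simp
  have P: "{u, v} \<in> pairs_in V" "{w, v} \<in> pairs_in V"
    using e mst_edges_subset by auto
  then have uwP: "{u, w} \<in> pairs_in V"
    using uw by (auto simp: pairs_in_def)
  have "{u, v} \<noteq> {w, v}"
    using uw by (auto simp: doubleton_eq_iff)
  then consider "c {w, v} < c {u, v}" | "c {u, v} < c {w, v}"
    using inj_onD[OF inj _ P] by fastforce
  then show False
  proof cases
    case 1
    let ?L = "adjacency (lighter_pairs V c (c {u, v}))"
    have "(u, w) \<in> ?L\<^sup>*" "(w, v) \<in> ?L\<^sup>*"
      using 1 less P uwP by (auto intro!: reach_edge simp: lighter_pairs_def)
    then have "(u, v) \<in> ?L\<^sup>*"
      by (rule rtrancl_trans)
    then show False
      using e(1) by (auto simp: mst_edges_def)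
  next
    case 2
    let ?L = "adjacency (lighter_pairs V c (c {w, v}))"
    have "(w, u) \<in> ?L\<^sup>*" "(u, v) \<in> ?L\<^sup>*"
      using 2 less P uwP by (auto intro!: reach_edge simp: lighter_pairs_def insert_commute)
    then have "(w, v) \<in> ?L\<^sup>*"
      by (rule rtrancl_trans)
    then show False
      using e(2) by (auto simp: mst_edges_def)
  qed
qed

section \<open>Replacing one vertex\<close>

text \<open>The old edges avoiding \<open>l\<close> survive, and the new tree has only one edge less
  in total. So at most \<open>k\<close> edges disappear, all at \<open>l\<close>, and at most
  \<open>k\<close> others appear.\<close>

lemma card_mst_edges_delete_vertex:
  assumes V: "finite V" "l \<in> V" "2 \<le> card V" and inj: "inj_on c (pairs_in V)"
    and deg: "vertex_degree (mst_edges V c) l \<le> k"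
  shows "card (sym_diff (mst_edges V c) (mst_edges (V - {l}) c)) \<le> 2 * k"
proof -
  let ?K = "mst_edges V c" and ?L = "mst_edges (V - {l}) c"
  let ?I = "{e \<in> ?K. l \<in> e}"
  have finK: "finite ?K" and finL: "finite ?L"
    using V finite_subset[OF mst_edges_subset finite_pairs_in] by blast+
  have ne: "V - {l} \<noteq> {}"
  proof
    assume "V - {l} = {}"
    then have "V = {l}"
      using V(2) by auto
    with V(3) show False
      by simp
  qed
  have injL: "inj_on c (pairs_in (V - {l}))"
    by (rule inj_on_subset[OF inj]) (auto simp: pairs_in_def)
  have cK: "Suc (card ?K) = card V"
    using V ne inj by (intro card_tree tree_mst_edges) auto
  have cL: "Suc (card ?L) = card (V - {l})"
    using V ne injL by (intro card_tree tree_mst_edges) auto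
  have "?K - ?I \<subseteq> ?K \<inter> pairs_in (V - {l})"
    using mst_edges_subset[of V c] by (auto simp: pairs_in_def)
  then have sub: "?K - ?I \<subseteq> ?L"
    using mst_edges_restrict[of "V - {l}" V c] by blast
  have cI: "card ?I \<le> k"
    using deg by (simp add: vertex_degree_def)
  have "card (?K - ?I) = card ?K - card ?I"
    using finK by (intro card_Diff_subset) auto
  moreover have "card (?L - (?K - ?I)) = card ?L - card (?K - ?I)"
    using finK sub by (intro card_Diff_subset) auto
  ultimately have "card (?L - (?K - ?I)) \<le> k"
    using cK cL cI V by simp
  then have "card (?I \<union> (?L - (?K - ?I))) \<le> 2 * k"
    using card_Un_le[of ?I "?L - (?K - ?I)"] cI by linarith
  moreover have "card (sym_diff ?K ?L) \<le> card (?I \<union> (?L - (?K - ?I)))"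
    using finK finL sub by (intro card_mono) auto
  ultimately show ?thesis
    by linarith
qed

lemma card_sym_diff_triangle:
  assumes "finite A" "finite B" "finite C"
  shows "card (sym_diff A C) \<le> card (sym_diff A B) + card (sym_diff B C)"
proof -
  have "card (sym_diff A C) \<le> card (sym_diff A B \<union> sym_diff B C)"
    using assms by (intro card_mono) auto
  also have "\<dots> \<le> card (sym_diff A B) + card (sym_diff B C)"
    by (rule card_Un_le)
  finally show ?thesis .
qed

text \<open>Off \<open>l\<close> the two weights agree, so both trees are compared with the same
  tree on \<open>V - {l}\<close>, at a cost of \<open>2 * k\<close> each.\<close>

lemma card_mst_edges_replace_vertex:
  assumes V: "finite V" "l \<in> V" "2 \<le> card V"
    and inj: "inj_on c (pairs_in V)" "inj_on c' (pairs_in V)"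
    and deg: "vertex_degree (mst_edges V c) l \<le> k" "vertex_degree (mst_edges V c') l \<le> k"
    and eq: "\<And>e. e \<in> pairs_in (V - {l}) \<Longrightarrow> c e = c' e"
  shows "card (sym_diff (mst_edges V c) (mst_edges V c')) \<le> 4 * k"
proof -
  have "card (sym_diff (mst_edges (V - {l}) c) (mst_edges V c')) \<le> 2 * k"
    using card_mst_edges_delete_vertex[OF V inj(2) deg(2)] mst_edges_cong[of "V - {l}" c c'] eq
    by (simp add: Un_commute)
  moreover have "card (sym_diff (mst_edges V c) (mst_edges (V - {l}) c)) \<le> 2 * k"
    by (rule card_mst_edges_delete_vertex[OF V inj(1) deg(1)])
  moreover have "finite (mst_edges U d)" if "finite U" for U and d :: "'a set \<Rightarrow> real"
    using that finite_subset[OF mst_edges_subset finite_pairs_in] by blast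
  ultimately show ?thesis
    using card_sym_diff_triangle[of "mst_edges V c" "mst_edges (V - {l}) c" "mst_edges V c'"] V(1)
    by fastforce
qed

section \<open>Degrees and the kissing number\<close>

lemma kissing_configuration_dist:
  fixes C :: "'a::euclidean_space set"
  assumes "kissing_configuration C" "a \<in> C" "b \<in> C" "a \<noteq> b"
  shows "2 \<le> dist a b"
proof (rule ccontr)
  assume "\<not> 2 \<le> dist a b"
  then have "midpoint a b \<in> ball a 1 \<inter> ball b 1"
    by (simp add: dist_midpoint)
  moreover have "ball a 1 \<inter> ball b 1 = {}"
    using assms by (simp add: kissing_configuration_def pairwise_def)
  ultimately show False
    by blast
qed

lemma kissing_configuration_norm_le:
  fixes C :: "'a::euclidean_space set"
  assumes "kissing_configuration C" "a \<in> C"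
  shows "norm a \<le> 2"
proof -
  obtain y where y: "y \<in> sphere a 1" "y \<in> sphere 0 1"
    using assms unfolding kissing_configuration_def by blast
  have "norm a \<le> norm y + dist a y"
    using norm_triangle_ineq[of y "a - y"] by (simp add: dist_norm)
  with y show ?thesis
    by simp
qed

text \<open>The kissing number is a \<open>Max\<close>, which is meaningful only for a finite set,
  so the cardinalities must be bounded. The centres lie within distance 2 of the origin, and each of
  the finitely many unit balls covering that region contains at most one of them.\<close>

lemma card_le_kissing_number:
  fixes C :: "'a::euclidean_space set"
  assumes C: "finite C" "kissing_configuration C"
  shows "card C \<le> kissing_number TYPE('a)"
proof -
  have "\<forall>\<epsilon>>0. \<exists>k. finite k \<and> cball (0::'a) 2 \<subseteq> (\<Union>x\<in>k. ball x \<epsilon>)"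
    using compact_cball[of "0::'a" 2] unfolding compact_eq_totally_bounded by blast
  then obtain N where N: "finite N" "cball (0::'a) 2 \<subseteq> (\<Union>x\<in>N. ball x 1)"
    using zero_less_one by blast
  have bound: "card D \<le> card N" if D: "kissing_configuration D" for D :: "'a set"
  proof -
    have "\<exists>x. x \<in> N \<and> a \<in> ball x 1" if "a \<in> D" for a
      using kissing_configuration_norm_le[OF D that] N(2) by force
    then obtain h where h: "\<And>a. a \<in> D \<Longrightarrow> h a \<in> N \<and> a \<in> ball (h a) 1"
      by metis
    have "inj_on h D"
    proof (rule inj_onI, rule ccontr)
      fix a b
      assume ab: "a \<in> D" "b \<in> D" "h a = h b" "a \<noteq> b"
      have "dist a b \<le> dist (h a) a + dist (h a) b"
        by (rule dist_triangle3)
      also have "\<dots> < 2"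
        using h[OF ab(1)] h[OF ab(2)] ab(3) by simp
      finally show False
        using kissing_configuration_dist[OF D ab(1,2,4)] by simp
    qed
    then show ?thesis
      using h N(1) by (intro card_inj_on_le[of h]) auto
  qed
  have "finite {card D | D :: 'a set. finite D \<and> kissing_configuration D}"
    by (rule finite_subset[of _ "{..card N}"]) (use bound in auto)
  then show ?thesis
    unfolding kissing_number_def using C by (intro Max_ge) auto
qed

text \<open>In the triangle with vertices \<open>0\<close>, \<open>a\<close>, \<open>b\<close> the
  side opposite \<open>0\<close> is longest, so the angle at \<open>0\<close> is at least 60 degrees
  and its cosine at most 1/2; for unit vectors this means distance at least 1.\<close>

lemma norm_sgn_diff_ge_1:
  fixes a b :: "'a::real_inner"
  assumes "a \<noteq> 0" "b \<noteq> 0" "norm a \<le> norm (a - b)" "norm b \<le> norm (a - b)"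
  shows "1 \<le> norm (sgn a - sgn b)"
proof -
  \<comment> \<open>With \<open>x\<close> the longer vector, expanding the square of
    \<open>norm (x - y)\<close> bounds \<open>2 * (x \<bullet> y)\<close> by the square of the
    shorter norm.\<close>
  have main: "2 * (x \<bullet> y) \<le> norm x * norm y" if "norm y \<le> norm x" "norm x \<le> norm (x - y)" for x y :: 'a
  proof -
    have "(norm x)\<^sup>2 \<le> (norm (x - y))\<^sup>2"
      using that(2) by (intro power_mono) auto
    then have "2 * (x \<bullet> y) \<le> (norm y)\<^sup>2"
      by (simp add: power2_norm_eq_inner inner_diff inner_commute)
    also have "\<dots> \<le> norm x * norm y"
      using that(1) by (simp add: power2_eq_square mult_right_mono)
    finally show ?thesis .
  qed
  have "2 * (a \<bullet> b) \<le> norm a * norm b"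
    using main[of b a] main[of a b] assms
    by (cases "norm b \<le> norm a") (auto simp: norm_minus_commute inner_commute mult.commute)
  then have "sgn a \<bullet> sgn b \<le> 1 / 2"
    using assms(1,2) by (simp add: sgn_div_norm field_simps)
  moreover have "(norm (sgn a - sgn b))\<^sup>2 = 2 - 2 * (sgn a \<bullet> sgn b)"
    using assms(1,2) norm_sgn[of a] norm_sgn[of b]
    by (simp add: power2_norm_eq_inner inner_diff inner_commute norm_eq_1)
  ultimately have "1 \<le> (norm (sgn a - sgn b))\<^sup>2"
    by simp
  then show ?thesis
    by (intro power2_le_imp_le[of 1]) simp_all
qed

text \<open>The unit sphere around \<open>2 *\<^sub>R u\<close> touches the central one at
  \<open>u\<close>; doubling turns separation 1 into 2, which makes the balls disjoint.\<close>

lemma kissing_configuration_doubled: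
  fixes U :: "'a::euclidean_space set"
  assumes "\<And>a. a \<in> U \<Longrightarrow> norm a = 1" "\<And>a b. a \<in> U \<Longrightarrow> b \<in> U \<Longrightarrow> a \<noteq> b \<Longrightarrow> 1 \<le> norm (a - b)"
  shows "kissing_configuration ((*\<^sub>R) 2 ` U)"
proof -
  have "0 \<notin> (*\<^sub>R) 2 ` U"
    using assms(1) by force
  moreover have "1 + 1 \<le> dist a b"
    if ab: "a \<in> insert 0 ((*\<^sub>R) 2 ` U)" "b \<in> insert 0 ((*\<^sub>R) 2 ` U)" "a \<noteq> b" for a b
  proof -
    have "dist (2 *\<^sub>R x) (2 *\<^sub>R y) = 2 * norm (x - y)" for x y :: 'a
      by (simp add: dist_norm flip: scaleR_diff_right)
    then show ?thesis
      using ab assms by fastforce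
  qed
  then have "pairwise (\<lambda>a b. ball a 1 \<inter> ball b 1 = {}) (insert 0 ((*\<^sub>R) 2 ` U))"
    by (intro pairwiseI disjoint_ballI)
  moreover have "sphere (2 *\<^sub>R u) 1 \<inter> sphere 0 1 \<noteq> {}" if "u \<in> U" for u
  proof -
    have "dist (2 *\<^sub>R u) u = norm u"
      by (simp add: dist_norm scaleR_2)
    then have "u \<in> sphere (2 *\<^sub>R u) 1 \<inter> sphere 0 1"
      using assms(1)[OF that] by simp
    then show ?thesis
      by blast
  qed
  ultimately show ?thesis
    by (simp add: kissing_configuration_def)
qed

text \<open>\<open>Min\<close> and \<open>Max\<close> recover the two ends, so that the weight is a
  function of the unordered pair.\<close>

definition pair_dist :: "(nat \<Rightarrow> 'a::metric_space) \<Rightarrow> nat set \<Rightarrow> real" where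
  "pair_dist x e = dist (x (Min e)) (x (Max e))"

lemma pair_dist_doubleton [simp]: "pair_dist x {u, v} = dist (x u) (x v)"
  by (cases u v rule: linorder_cases) (auto simp: pair_dist_def dist_commute)

text \<open>Coincident points have the same distance to any third point. With only two vertices
  there is a single pair, and injectivity would say nothing.\<close>

lemma inj_points_if_inj_pair_dist:
  assumes inj: "inj_on (pair_dist x) (pairs_in V)" and V: "3 \<le> card V" "u \<in> V" "v \<in> V" "u \<noteq> v"
  shows "x u \<noteq> x v"
proof
  assume eq: "x u = x v"
  have "\<not> V \<subseteq> {u, v}"
    using V card_mono[of "{u, v}" V] by auto
  then obtain w where w: "w \<in> V" "w \<noteq> u" "w \<noteq> v"
    by blast
  have "{u, w} = {v, w}"
    by (rule inj_onD[OF inj]) (use V w eq in \<open>auto simp: pairs_in_def\<close>)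
  with V w show False
    by (auto simp: doubleton_eq_iff)
qed

text \<open>The directions from \<open>v\<close> to its neighbours are pairwise at distance at least
  1, so they form a kissing configuration after doubling.\<close>

lemma vertex_degree_mst_le_kissing_number:
  fixes x :: "nat \<Rightarrow> 'a::euclidean_space"
  assumes V: "finite V" "3 \<le> card V" and inj: "inj_on (pair_dist x) (pairs_in V)"
  shows "vertex_degree (mst_edges V (pair_dist x)) v \<le> kissing_number TYPE('a)"
proof -
  let ?K = "mst_edges V (pair_dist x)"
  define N where "N = {u. {u, v} \<in> ?K}"
  define d where "d u = sgn (x u - x v)" for u
  have K: "?K \<subseteq> pairs_in V"
    by (rule mst_edges_subset)
  have NV: "u \<in> V \<and> v \<in> V \<and> u \<noteq> v" if "u \<in> N" for u
    using that K by (auto simp: N_def dest: mem_pairs_inD)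
  have ne: "x u \<noteq> x v" if "u \<in> N" for u
    using inj_points_if_inj_pair_dist[OF inj V(2)] NV[OF that] by blast
  have dist: "1 \<le> norm (d u - d w)" if uw: "u \<in> N" "w \<in> N" "u \<noteq> w" for u w
    unfolding d_def
  proof (rule norm_sgn_diff_ge_1)
    \<comment> \<open>Applied with the neighbours in both orders: neither edge at \<open>v\<close>
      is longer than the distance between them.\<close>
    have "pair_dist x {u, v} \<le> pair_dist x {u, w}" "pair_dist x {w, v} \<le> pair_dist x {w, u}"
      using uw by (auto simp only: N_def mem_Collect_eq intro!: mst_edges_adjacent_le[OF inj])
    then show "norm (x u - x v) \<le> norm (x u - x v - (x w - x v))"
      "norm (x w - x v) \<le> norm (x u - x v - (x w - x v))"
      by (simp_all add: dist_norm norm_minus_commute)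
  qed (use ne uw in auto)
  have finN: "finite N"
    using NV V(1) by (meson finite_subset subsetI)
  \<comment> \<open>Separation by 1 forces distinct directions, so no neighbour is lost in passing
    to unit vectors.\<close>
  have inj_d: "inj_on d N"
    using dist by (fastforce intro: inj_onI)
  have "{e \<in> ?K. v \<in> e} \<subseteq> (\<lambda>u. {u, v}) ` N"
  proof
    fix e
    assume e: "e \<in> {e \<in> ?K. v \<in> e}"
    then obtain a b where "e = {a, b}"
      using K by (metis (no_types, lifting) mem_Collect_eq pairs_inE subsetD)
    with e show "e \<in> (\<lambda>u. {u, v}) ` N"
      by (auto simp: N_def insert_commute)
  qed
  then have "vertex_degree ?K v \<le> card ((\<lambda>u. {u, v}) ` N)"
    unfolding vertex_degree_def using finN by (intro card_mono) auto
  also have "\<dots> \<le> card N"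
    by (rule card_image_le[OF finN])
  also have "card N = card ((*\<^sub>R) 2 ` d ` N)"
    using inj_d by (simp add: card_image inj_on_def)
  also have "\<dots> \<le> kissing_number TYPE('a)"
  proof (intro card_le_kissing_number kissing_configuration_doubled)
    show "norm a = 1" if "a \<in> d ` N" for a
      using that ne by (auto simp: d_def norm_sgn)
    show "1 \<le> norm (a - b)" if "a \<in> d ` N" "b \<in> d ` N" "a \<noteq> b" for a b
      using that dist by blast
  qed (use finN in auto)
  finally show ?thesis .
qed

section \<open>The minimizer at points with distinct distances\<close>

lemma tree_cost_eq_sum:
  assumes "E \<subseteq> pairs_in V"
  shows "tree_cost q x E = (\<Sum>e\<in>E. pair_dist x e powr q)"
proof -
  let ?S = "{(i, j). i < j \<and> {i, j} \<in> E}"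
  have "bij_betw (\<lambda>(i, j). {i, j}) ?S E"
  proof (intro bij_betw_imageI inj_onI)
    show "(\<lambda>(i, j). {i, j}) ` ?S = E"
    proof (intro equalityI subsetI)
      fix e
      assume e: "e \<in> E"
      then obtain a b where "e = {a, b}" "a < b"
        using assms by (metis insert_commute linorder_neqE_nat pairs_inE subsetD)
      with e show "e \<in> (\<lambda>(i, j). {i, j}) ` ?S"
        by (intro image_eqI[of _ _ "(a, b)"]) auto
    qed auto
  qed (auto simp: doubleton_eq_iff)
  then have "(\<Sum>e\<in>E. pair_dist x e powr q) = (\<Sum>p\<in>?S. pair_dist x (case p of (i, j) \<Rightarrow> {i, j}) powr q)"
    by (rule sum.reindex_bij_betw[symmetric])
  then show ?thesis
    by (simp add: tree_cost_def case_prod_beta dist_norm)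
qed

lemma pair_dist_nonneg: "0 \<le> pair_dist x e"
  by (simp add: pair_dist_def)

lemma pair_dist_powr_less_iff:
  assumes "0 < q"
  shows "pair_dist x e powr q < pair_dist x e' powr q \<longleftrightarrow> pair_dist x e < pair_dist x e'"
  using powr_less_mono2[OF assms pair_dist_nonneg, of x e "pair_dist x e'"]
    powr_mono2[of q "pair_dist x e'" "pair_dist x e"] assms pair_dist_nonneg[of x e']
  by linarith

text \<open>Only the order of the weights enters \<open>mst_edges\<close>, and it is the same for
  distances and for their powers.\<close>

lemma mst_edges_powr:
  assumes "0 < q"
  shows "mst_edges V (\<lambda>e. pair_dist x e powr q) = mst_edges V (pair_dist x)"
  unfolding mst_edges_def lighter_pairs_def pair_dist_powr_less_iff[OF assms] ..

text \<open>The degree bound puts \<open>mst_edges\<close> into the class, so the minimizer costs at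
  most as much; uniqueness among all trees identifies the two.\<close>

lemma mst_minimizer_eq_mst_edges:
  fixes x :: "nat \<Rightarrow> 'a::euclidean_space"
  assumes q: "0 < q" and n: "3 \<le> n" and inj: "inj_on (pair_dist x) (pairs_in {1..n})"
  shows "mst_minimizer q n x = mst_edges {1..n} (pair_dist x)"
proof -
  let ?c = "\<lambda>e. pair_dist x e powr q" and ?C = "mst_class TYPE('a) n"
  let ?E = "mst_minimizer q n x" and ?K = "mst_edges {1..n} (pair_dist x)"
  have injc: "inj_on ?c (pairs_in {1..n})"
  proof (rule inj_onI)
    fix e e'
    assume e: "e \<in> pairs_in {1..n}" "e' \<in> pairs_in {1..n}" "?c e = ?c e'"
    then have "pair_dist x e = pair_dist x e'"
      using pair_dist_powr_less_iff[OF q, of x e e'] pair_dist_powr_less_iff[OF q, of x e' e]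
      by linarith
    then show "e = e'"
      using e(1,2) by (rule inj_onD[OF inj])
  qed
  have C: "E \<in> ?C \<longleftrightarrow> tree_on {1..n} E \<and> (\<forall>v\<in>{1..n}. vertex_degree E v \<le> kissing_number TYPE('a))" for E
    by (simp add: mst_class_def bounded_degree_trees_def)
  have simple: "E \<subseteq> pairs_in {1..n}" if "E \<in> ?C" for E
    using that by (simp add: C tree_on_iff simple_graph_on_iff)
  have K: "?K \<in> ?C"
    using n inj unfolding C
    by (intro conjI tree_mst_edges ballI vertex_degree_mst_le_kissing_number) auto
  have "finite ?C"
    by (rule finite_subset[of _ "Pow (pairs_in {1..n})"]) (use simple in \<open>auto simp: finite_pairs_in\<close>)
  \<comment> \<open>The class is finite and nonempty, so \<open>arg_min_on\<close> attains the
    minimum.\<close>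
  then have E: "?E \<in> ?C" "tree_cost q x ?E \<le> tree_cost q x ?K"
    unfolding mst_minimizer_def using K by (auto intro: arg_min_if_finite(1) arg_min_least)
  have "?E = mst_edges {1..n} ?c"
  proof (rule mst_edges_unique_minimizer[OF _ _ injc])
    show "tree_on {1..n} ?E"
      using E(1) by (simp add: C)
    show "sum ?c ?E \<le> sum ?c (mst_edges {1..n} ?c)"
      using E(2) unfolding tree_cost_eq_sum[OF simple[OF E(1)]] tree_cost_eq_sum[OF simple[OF K]]
      by (simp add: mst_edges_powr[OF q])
  qed (use n in auto)
  then show ?thesis
    by (simp add: mst_edges_powr[OF q])
qed

lemma edge_dist_mst_minimizer_fun_upd:
  fixes x :: "nat \<Rightarrow> 'a::euclidean_space"
  assumes q: "0 < q" and n: "3 \<le> n" and l: "l \<in> {1..n}"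
    and inj: "inj_on (pair_dist x) (pairs_in {1..n})" "inj_on (pair_dist (x(l := y))) (pairs_in {1..n})"
  shows "edge_dist n (mst_minimizer q n x) (mst_minimizer q n (x(l := y)))
    \<le> 4 * real (kissing_number TYPE('a)) / real n"
proof -
  have "card (sym_diff (mst_edges {1..n} (pair_dist x)) (mst_edges {1..n} (pair_dist (x(l := y)))))
      \<le> 4 * kissing_number TYPE('a)"
  proof (rule card_mst_edges_replace_vertex[OF _ l _ inj])
    fix e
    assume "e \<in> pairs_in ({1..n} - {l})"
    then obtain u v where "e = {u, v}" "u \<noteq> l" "v \<noteq> l"
      by (auto elim!: pairs_inE)
    then show "pair_dist x e = pair_dist (x(l := y)) e"
      by simp
  qed (use n inj in \<open>auto intro!: vertex_degree_mst_le_kissing_number\<close>)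
  then show ?thesis
    unfolding edge_dist_def mst_minimizer_eq_mst_edges[OF q n inj(1)]
      mst_minimizer_eq_mst_edges[OF q n inj(2)]
    by (intro divide_right_mono) linarith+
qed

lemma finite_mst_minimizer:
  fixes x :: "nat \<Rightarrow> 'a::euclidean_space"
  assumes "0 < q" "3 \<le> n" "inj_on (pair_dist x) (pairs_in {1..n})"
  shows "finite (mst_minimizer q n x)"
  unfolding mst_minimizer_eq_mst_edges[OF assms]
  by (rule finite_subset[OF mst_edges_subset finite_pairs_in]) simp

section \<open>Packing numbers of the perturbed minimizers\<close>

lemma packing_number_le_1:
  assumes T: "finite T" and small: "\<And>x y. x \<in> T \<Longrightarrow> y \<in> T \<Longrightarrow> d x y \<le> \<epsilon>"
  shows "packing_number T d \<epsilon> \<le> 1"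
proof -
  let ?S = "{card S | S. S \<subseteq> T \<and> finite S \<and> pairwise (\<lambda>x y. d x y > \<epsilon>) S}"
  have "k \<le> 1" if k: "k \<in> ?S" for k
  proof -
    obtain S where S: "k = card S" "S \<subseteq> T" "finite S" "pairwise (\<lambda>x y. d x y > \<epsilon>) S"
      using k by blast
    have "x = y" if "x \<in> S" "y \<in> S" for x y
      using S(2,4) small[of x y] that by (force simp: pairwise_def)
    then show ?thesis
      using S(1,3) by (auto simp: card_le_Suc0_iff_eq)
  qed
  \<comment> \<open>The empty packing makes the set of cardinalities nonempty, as \<open>Max\<close>
    requires.\<close>
  moreover have "0 \<in> ?S"
    by (rule CollectI, rule exI[of _ "{}"]) simp
  moreover have "finite ?S"
    by (rule finite_subset[of _ "{..1}"]) (use calculation(1) in auto)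
  ultimately show ?thesis
    unfolding packing_number_def by (subst Max_le_iff) blast+
qed

text \<open>Taking all blocks already gives packing number at most 1. With k the kissing number,
  each perturbed tree is within \<open>4 * k / n\<close> of the unperturbed one, so any two are
  within \<open>8 * k / n\<close>, which is at most \<open>\<epsilon>\<close> by the hypothesis on
  \<open>n\<close>.\<close>

lemma min_packing_number_le_1:
  fixes x :: "nat \<Rightarrow> 'a::euclidean_space"
  assumes q: "0 < q" and n: "3 \<le> n" and \<epsilon>: "0 < \<epsilon>"
    and small: "8 * real (kissing_number TYPE('a)) \<le> \<epsilon> * real n"
    and inj: "inj_on (pair_dist x) (pairs_in {1..n})"
      "\<And>l. l \<in> {1..n} \<Longrightarrow> inj_on (pair_dist (x(l := y l))) (pairs_in {1..n})"
  shows "Min {packing_number ((\<lambda>l. mst_minimizer q n (x(l := y l))) ` A) (edge_dist n) \<epsilon>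
           | A. A \<subseteq> {1..n} \<and> real (card A) > (1 - \<epsilon>) * real (card {1..n})} \<le> 1"
proof -
  let ?T = "\<lambda>l. mst_minimizer q n (x(l := y l))" and ?k = "real (kissing_number TYPE('a))"
  let ?M = "{packing_number (?T ` A) (edge_dist n) \<epsilon>
    | A. A \<subseteq> {1..n} \<and> real (card A) > (1 - \<epsilon>) * real (card {1..n})}"
  have near: "edge_dist n (mst_minimizer q n x) (?T l) \<le> 4 * ?k / real n" if "l \<in> {1..n}" for l
    by (rule edge_dist_mst_minimizer_fun_upd[OF q n that inj(1) inj(2)[OF that]])
  have "edge_dist n (?T l) (?T m) \<le> \<epsilon>" if lm: "l \<in> {1..n}" "m \<in> {1..n}" for l m
  proof -
    have "card (sym_diff (?T l) (?T m))
        \<le> card (sym_diff (?T l) (mst_minimizer q n x)) + card (sym_diff (mst_minimizer q n x) (?T m))"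
      using q n inj lm by (intro card_sym_diff_triangle finite_mst_minimizer) auto
    then have "edge_dist n (?T l) (?T m)
        \<le> edge_dist n (mst_minimizer q n x) (?T l) + edge_dist n (mst_minimizer q n x) (?T m)"
      unfolding edge_dist_def
      by (simp add: Un_commute divide_right_mono flip: add_divide_distrib of_nat_add)
    also have "\<dots> \<le> 8 * ?k / real n"
      using near[OF lm(1)] near[OF lm(2)] by simp
    also have "\<dots> \<le> \<epsilon>"
      using small n by (simp add: field_simps)
    finally show ?thesis .
  qed
  then have "packing_number (?T ` {1..n}) (edge_dist n) \<epsilon> \<le> 1"
    by (intro packing_number_le_1) auto
  \<comment> \<open>The full set is admissible since
    \<open>(1 - \<epsilon>) * n < n\<close>.\<close>
  moreover have "packing_number (?T ` {1..n}) (edge_dist n) \<epsilon> \<in> ?M"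
    using \<epsilon> n by (intro CollectI exI[of _ "{1..n}"]) simp
  moreover have "finite ?M"
    by (rule finite_subset[of _ "(\<lambda>A. packing_number (?T ` A) (edge_dist n) \<epsilon>) ` Pow {1..n}"]) auto
  ultimately show ?thesis
    by (meson Min_le order_trans)
qed

section \<open>Almost surely, all distances are distinct\<close>

text \<open>By Fubini: with all coordinates but \<open>i\<close> fixed, the bad values of
  \<open>z i\<close> lie on a sphere around \<open>z j\<close>. For \<open>k = m\<close> the sphere
  degenerates to a point.\<close>

lemma AE_PiM_dist_neq:
  fixes P :: "'a::euclidean_space measure"
  assumes P: "prob_space P" "sets P = sets borel" and null: "\<And>a r. emeasure P (sphere a r) = 0"
    and I: "finite I" "i \<in> I" and jkm: "j \<in> I - {i}" "k \<in> I - {i}" "m \<in> I - {i}"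
  shows "AE z in PiM I (\<lambda>_. P). dist (z i) (z j) \<noteq> dist (z k) (z m)"
proof -
  interpret prob_space P
    by fact
  interpret product_sigma_finite "\<lambda>_. P"
    by unfold_locales
  have comp: "(\<lambda>z. z a) \<in> borel_measurable (PiM I (\<lambda>_. P))" if "a \<in> I" for a
    using measurable_component_singleton[OF that, of "\<lambda>_. P"]
    by (simp add: measurable_cong_sets[OF refl P(2)])
  define B where "B = {z \<in> space (PiM I (\<lambda>_. P)). dist (z i) (z j) = dist (z k) (z m)}"
  note [measurable] = comp[of i] comp[of j] comp[of k] comp[of m]
  have "B \<in> sets (PiM I (\<lambda>_. P))"
    unfolding B_def using I jkm by simp
  then have "emeasure (PiM I (\<lambda>_. P)) B = (\<integral>\<^sup>+ z. indicator B z \<partial>PiM I (\<lambda>_. P))"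
    by simp
  also have "\<dots> = (\<integral>\<^sup>+ z. (\<integral>\<^sup>+ y. indicator B (z(i := y)) \<partial>P) \<partial>PiM (I - {i}) (\<lambda>_. P))"
    using product_nn_integral_insert[of "I - {i}" i "indicator B"] I \<open>B \<in> _\<close>
    by (simp add: insert_absorb)
  also have "\<dots> \<le> (\<integral>\<^sup>+ z. 0 \<partial>PiM (I - {i}) (\<lambda>_. P))"
  proof (rule nn_integral_mono)
    fix z :: "'b \<Rightarrow> 'a"
    have "(\<integral>\<^sup>+ y. indicator B (z(i := y)) \<partial>P)
        \<le> (\<integral>\<^sup>+ y. indicator (sphere (z j) (dist (z k) (z m))) y \<partial>P)"
      using jkm by (intro nn_integral_mono) (auto simp: B_def indicator_def dist_commute)
    also have "\<dots> = emeasure P (sphere (z j) (dist (z k) (z m)))"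
      by (rule nn_integral_indicator) (simp add: P(2))
    finally show "(\<integral>\<^sup>+ y. indicator B (z(i := y)) \<partial>P) \<le> 0"
      by (simp add: null)
  qed
  finally have "emeasure (PiM I (\<lambda>_. P)) B = 0"
    by simp
  then have "B \<in> null_sets (PiM I (\<lambda>_. P))"
    using \<open>B \<in> _\<close> by auto
  then have "AE z in PiM I (\<lambda>_. P). z \<notin> B"
    by (rule AE_not_in)
  then show ?thesis
    using AE_space by eventually_elim (simp add: B_def)
qed

lemma AE_PiM_inj_pair_dist:
  fixes P :: "'a::euclidean_space measure"
  assumes P: "prob_space P" "sets P = sets borel" and null: "\<And>a r. emeasure P (sphere a r) = 0"
    and I: "finite I"
  shows "AE z in PiM I (\<lambda>_. P). inj_on (pair_dist z) (pairs_in I)"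
proof -
  have neq: "AE z in PiM I (\<lambda>_. P). pair_dist z e \<noteq> pair_dist z e'"
    if e: "e \<in> pairs_in I" "e' \<in> pairs_in I" "e \<noteq> e'" for e e'
  proof -
    have card: "card e = 2" "card e' = 2" "finite e" "finite e'"
      using e I by (auto simp: pairs_in_def intro: finite_subset)
    \<comment> \<open>Two different sets of equal size: some index \<open>i\<close> lies in
      \<open>e\<close> only, so its point varies while the other distance stays fixed.\<close>
    then have "\<not> e \<subseteq> e'"
      using e(3) card_subset_eq[of e' e] by auto
    then obtain i where i: "i \<in> e" "i \<notin> e'"
      by blast
    obtain j where j: "e = {i, j}" "j \<noteq> i"
      using i(1) card(1) by (auto simp: card_2_iff doubleton_eq_iff)
    obtain k m where km: "e' = {k, m}"
      using card(2) by (auto simp: card_2_iff)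
    have "i \<in> I" "j \<in> I - {i}" "k \<in> I - {i}" "m \<in> I - {i}"
      using e i j km by (auto simp: pairs_in_def)
    from AE_PiM_dist_neq[OF P null I this] show ?thesis
      by (simp add: j km)
  qed
  have "AE z in PiM I (\<lambda>_. P). \<forall>e\<in>pairs_in I. \<forall>e'\<in>pairs_in I. e \<noteq> e' \<longrightarrow> pair_dist z e \<noteq> pair_dist z e'"
    using neq finite_pairs_in[OF I] by (intro AE_finite_allI AE_impI) auto
  then show ?thesis
    by eventually_elim (auto simp: inj_on_def)
qed

section \<open>The law of the perturbed sample\<close>

lemma iid_sample_distr:
  fixes X :: "'w \<Rightarrow> 'i \<Rightarrow> 'a::topological_space"
  assumes M: "prob_space M" and X: "iid_sample M I X P" and I: "I \<noteq> {}"
  shows "distr M (PiM I (\<lambda>_. borel)) X = PiM I (\<lambda>_. P)"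
proof -
  interpret prob_space M
    by fact
  have rv: "X \<in> M \<rightarrow>\<^sub>M PiM I (\<lambda>_. borel)"
    and ind: "indep_vars (\<lambda>_. borel) (\<lambda>i \<omega>. X \<omega> i) I"
    and law: "\<And>i. i \<in> I \<Longrightarrow> distr M borel (\<lambda>\<omega>. X \<omega> i) = P"
    using X by (auto simp: iid_sample_def)
  have "random_variable borel (\<lambda>\<omega>. X \<omega> i)" if "i \<in> I" for i
    using measurable_compose[OF rv measurable_component_singleton[OF that]] .
  then have "distr M (PiM I (\<lambda>_. borel)) (\<lambda>\<omega>. \<lambda>i\<in>I. X \<omega> i) = PiM I (\<lambda>i. distr M borel (\<lambda>\<omega>. X \<omega> i))"
    using indep_vars_iff_distr_eq_PiM'[OF I, where M' = "\<lambda>_. borel" and X = "\<lambda>i \<omega>. X \<omega> i"] ind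
    by simp
  \<comment> \<open>As points of the product space, the values of \<open>X\<close> are already
    \<open>undefined\<close> outside \<open>I\<close>, so restricting them changes nothing.\<close>
  moreover have "distr M (PiM I (\<lambda>_. borel)) (\<lambda>\<omega>. \<lambda>i\<in>I. X \<omega> i) = distr M (PiM I (\<lambda>_. borel)) X"
  proof (rule distr_cong)
    fix \<omega>
    assume "\<omega> \<in> space M"
    then have "X \<omega> \<in> extensional I"
      using measurable_space[OF rv] by (auto simp: space_PiM PiE_def)
    then show "(\<lambda>i\<in>I. X \<omega> i) = X \<omega>"
      by (rule extensional_restrict)
  qed simp_all
  moreover have "PiM I (\<lambda>i. distr M borel (\<lambda>\<omega>. X \<omega> i)) = PiM I (\<lambda>_. P)"
    by (intro PiM_cong refl law)
  ultimately show ?thesis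
    by simp
qed

text \<open>The preimage of a rectangle is a product of two rectangles: the side at \<open>l\<close>
  moves to the second factor, and the whole space, of mass 1, fills the gaps.\<close>

lemma distr_PiM_fun_upd:
  fixes P :: "'a measure" and I :: "'i set"
  assumes P: "prob_space P" and I: "finite I" "l \<in> I"
  shows "distr (PiM I (\<lambda>_. P) \<Otimes>\<^sub>M PiM I (\<lambda>_. P)) (PiM I (\<lambda>_. P)) (\<lambda>(x, y). x(l := y l)) = PiM I (\<lambda>_. P)"
proof -
  interpret prob_space P
    by fact
  interpret product_sigma_finite "\<lambda>_. P"
    by unfold_locales
  let ?N = "PiM I (\<lambda>_. P)"
  interpret N: prob_space ?N
    by (intro prob_space_PiM P)
  have upd: "(\<lambda>(x, y). x(l := y l)) \<in> ?N \<Otimes>\<^sub>M ?N \<rightarrow>\<^sub>M ?N"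
    unfolding case_prod_beta' by (rule measurable_fun_upd[where J = I]) (use I in auto)
  show ?thesis
  proof (rule PiM_eqI[OF I(1)])
    fix A
    assume A: "\<And>i. i \<in> I \<Longrightarrow> A i \<in> sets P"
    let ?B = "A(l := space P)" and ?C = "\<lambda>i. if i = l then A l else space P"
    have A': "\<And>i. i \<in> I \<Longrightarrow> ?B i \<in> sets P" "\<And>i. i \<in> I \<Longrightarrow> ?C i \<in> sets P"
      using A I by auto
    have pre: "(\<lambda>(x, y). x(l := y l)) -` Pi\<^sub>E I A \<inter> space (?N \<Otimes>\<^sub>M ?N) = Pi\<^sub>E I ?B \<times> Pi\<^sub>E I ?C"
    proof (rule set_eqI)
      fix p :: "('i \<Rightarrow> 'a) \<times> ('i \<Rightarrow> 'a)"
      obtain x y where p: "p = (x, y)"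
        by (rule prod.exhaust)
      have sub: "a \<in> space P" if "a \<in> A i" "i \<in> I" for a i
        using sets.sets_into_space[OF A[OF that(2)]] that(1) by (rule subsetD)
      have ext: "x(l := y l) \<in> extensional I" if "x \<in> extensional I"
        using that I(2) by (auto simp: extensional_def)
      have "p \<in> (\<lambda>(x, y). x(l := y l)) -` Pi\<^sub>E I A \<inter> space (?N \<Otimes>\<^sub>M ?N) \<longleftrightarrow>
          x \<in> extensional I \<and> y \<in> extensional I \<and> (\<forall>i\<in>I. x i \<in> space P) \<and> (\<forall>i\<in>I. y i \<in> space P) \<and>
          (\<forall>i\<in>I. (x(l := y l)) i \<in> A i)"
        using ext by (auto simp only: p vimage_eq Int_iff prod.case space_pair_measure space_PiM mem_Times_iff
            fst_conv snd_conv PiE_iff)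
      also have "\<dots> \<longleftrightarrow> x \<in> extensional I \<and> y \<in> extensional I \<and>
          (\<forall>i\<in>I. x i \<in> ?B i) \<and> (\<forall>i\<in>I. y i \<in> ?C i)"
        using sub I(2) by (auto split: if_splits)
      also have "\<dots> \<longleftrightarrow> p \<in> Pi\<^sub>E I ?B \<times> Pi\<^sub>E I ?C"
        by (auto simp only: p mem_Times_iff fst_conv snd_conv PiE_iff)
      finally show "p \<in> (\<lambda>(x, y). x(l := y l)) -` Pi\<^sub>E I A \<inter> space (?N \<Otimes>\<^sub>M ?N) \<longleftrightarrow>
          p \<in> Pi\<^sub>E I ?B \<times> Pi\<^sub>E I ?C" .
    qed
    have "emeasure (distr (?N \<Otimes>\<^sub>M ?N) ?N (\<lambda>(x, y). x(l := y l))) (Pi\<^sub>E I A)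
        = emeasure (?N \<Otimes>\<^sub>M ?N) (Pi\<^sub>E I ?B \<times> Pi\<^sub>E I ?C)"
      using A I(1) by (subst emeasure_distr[OF upd sets_PiM_I_finite]) (simp_all only: pre)
    also have "\<dots> = emeasure ?N (Pi\<^sub>E I ?B) * emeasure ?N (Pi\<^sub>E I ?C)"
      using A' I by (intro N.emeasure_pair_measure_Times sets_PiM_I_finite) auto
    also have "\<dots> = (\<Prod>i\<in>I. emeasure P (?B i)) * (\<Prod>i\<in>I. emeasure P (?C i))"
      using A' I by (simp only: emeasure_PiM)
    also have "\<dots> = (\<Prod>i\<in>I. emeasure P (A i))"
      unfolding prod.distrib[symmetric]
      by (rule prod.cong) (auto simp: emeasure_space_1)
    finally show "emeasure (distr (?N \<Otimes>\<^sub>M ?N) ?N (\<lambda>(x, y). x(l := y l))) (Pi\<^sub>E I A)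
        = (\<Prod>i\<in>I. emeasure P (A i))" .
  qed simp
qed

text \<open>By independence the sample and its copy have the product law, so the perturbed sample
  has the law of the original and inherits its almost sure properties.\<close>

lemma AE_iid_sample_fun_upd:
  fixes X X' :: "'w \<Rightarrow> 'i \<Rightarrow> 'a::topological_space"
  assumes M: "prob_space M" and P: "prob_space P" and X: "iid_sample M I X P"
    and copy: "independent_copy M (PiM I (\<lambda>_. borel)) X X'"
    and I: "finite I" "l \<in> I"
    and Q: "AE z in PiM I (\<lambda>_. P). Q z"
  shows "AE \<omega> in M. Q ((X \<omega>)(l := X' \<omega> l))"
proof -
  interpret prob_space M
    by fact
  let ?N = "PiM I (\<lambda>_. borel) :: ('i \<Rightarrow> 'a) measure" and ?\<mu> = "PiM I (\<lambda>_. P)"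
  have "P = distr M borel (\<lambda>\<omega>. X \<omega> l)"
    using X I by (simp add: iid_sample_def)
  then have "sets P = sets borel"
    by simp
  then have sets: "sets ?\<mu> = sets ?N"
    by (intro sets_PiM_cong) auto
  have X\<mu>: "distr M ?N X = ?\<mu>"
    using I by (intro iid_sample_distr[OF M X]) auto
  have rv: "random_variable ?N X" "random_variable ?N X'"
    and joint: "distr M (?N \<Otimes>\<^sub>M ?N) (\<lambda>\<omega>. (X \<omega>, X' \<omega>)) = ?\<mu> \<Otimes>\<^sub>M ?\<mu>"
    using copy X\<mu> unfolding independent_copy_def indep_var_distribution_eq by auto
  have "AE z in distr (?\<mu> \<Otimes>\<^sub>M ?\<mu>) ?\<mu> (\<lambda>(x, y). x(l := y l)). Q z"
    unfolding distr_PiM_fun_upd[OF P I] by (rule Q)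
  moreover have "(\<lambda>(x, y). x(l := y l)) \<in> ?\<mu> \<Otimes>\<^sub>M ?\<mu> \<rightarrow>\<^sub>M ?\<mu>"
    unfolding case_prod_beta' by (rule measurable_fun_upd[where J = I]) (use I in auto)
  ultimately have "AE p in ?\<mu> \<Otimes>\<^sub>M ?\<mu>. Q ((\<lambda>(x, y). x(l := y l)) p)"
    by (rule AE_distrD[rotated])
  then have "AE p in distr M (?N \<Otimes>\<^sub>M ?N) (\<lambda>\<omega>. (X \<omega>, X' \<omega>)). Q ((\<lambda>(x, y). x(l := y l)) p)"
    unfolding joint .
  from AE_distrD[OF measurable_Pair[OF rv] this] show ?thesis
    unfolding prod.case .
qed

text \<open>A set that is not measurable has \<open>measure\<close> 0 by convention, in agreement
  with the null case.\<close>

lemma measure_eq_0_if_AE_not: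
  assumes "AE \<omega> in M. \<not> Q \<omega>"
  shows "measure M {\<omega> \<in> space M. Q \<omega>} = 0"
proof (cases "{\<omega> \<in> space M. Q \<omega>} \<in> sets M")
  case True
  then have "{\<omega> \<in> space M. Q \<omega>} \<in> null_sets M"
    using assms by (subst AE_iff_null_sets) auto
  then show ?thesis
    by (simp add: measure_eq_0_null_sets)
qed (rule measure_notin_sets)

theorem theorem3p9p7:
  fixes P :: "(real ^ 'd) measure"
    and f :: "real ^ 'd \<Rightarrow> real"
    and q :: real
    and M :: "nat \<Rightarrow> 'w measure"
    and X :: "nat \<Rightarrow> 'w \<Rightarrow> nat \<Rightarrow> real ^ 'd"
    and X' :: "nat \<Rightarrow> nat \<Rightarrow> 'w \<Rightarrow> nat \<Rightarrow> real ^ 'd"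
  assumes dim: "CARD('d) \<ge> 2"
    and q: "1 \<le> q" "q < real CARD('d)"
    and P: "prob_space P"
    and M: "\<And>n. prob_space (M n)"
    and sample: "\<And>n. iid_sample (M n) {1..n} (X n) P"
    and copies: "\<And>n l. l \<in> {1..n} \<Longrightarrow>
      independent_copy (M n) (PiM {1..n} (\<lambda>_. borel)) (X n) (X' n l)"
    and dens: "f \<in> borel_measurable borel" "\<And>x. 0 \<le> f x" "P = density lborel (\<lambda>x. ennreal (f x))"
    and f_bounded: "bounded (range f)"
    and f_cont: "AE x in lborel. isCont f x"
    and moment: "integrable P (\<lambda>x. norm x powr q)"
    and cost_growth: "(\<lambda>n. \<integral>\<omega>. (INF E\<in>mst_class TYPE(real ^ 'd) n. tree_cost q (X n \<omega>) E) \<partial>M n)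
      \<in> O(\<lambda>n. real n powr ((real CARD('d) - q) / real CARD('d)))"
    and regular: "(\<exists>(\<rho> :: real ^ 'p \<Rightarrow> real) (g :: real ^ 'p \<Rightarrow> real ^ 'd).
          langevin_assumption P \<rho> g \<and> (AE y in lebesgue. jacobian g (at y) \<noteq> 0))
        \<or> (q < 1 + 2 / real CARD('d) \<and> rejection_assumption P f)"
    and shells: "summable (\<lambda>k. shell_coeff q f k powr ((real CARD('d) - q) / real CARD('d)))"
  shows "stable_under_small_perturbations M (\<lambda>n. {1..n}) X X' (mst_minimizer q) edge_dist
    (\<lambda>n. {1..n}) (\<lambda>n i. {i})"
  unfolding stable_under_small_perturbations_def
proof (intro conjI allI impI)
  show "perturbation_blocks {1..n} {1..n} (\<lambda>i. {i})" for n :: nat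
    by (auto simp: perturbation_blocks_def)
next
  fix \<epsilon> \<delta> :: real
  assume \<epsilon>: "0 < \<epsilon>" and \<delta>: "0 < \<delta>"
  have sets: "sets P = sets borel"
    by (simp add: dens(3))
  \<comment> \<open>Spheres are Lebesgue null sets, and \<open>P\<close> has a density.\<close>
  have sphere_null: "emeasure P (sphere a r) = 0" for a r
  proof -
    have "sphere a r \<in> null_sets lborel"
      using negligible_sphere[of a r] by (simp add: negligible_iff_null_sets null_sets_completion_iff)
    then have "AE x in P. x \<notin> sphere a r"
      unfolding dens(3) using dens(1) by (subst AE_density) (auto dest: AE_not_in)
    then show ?thesis
      by (subst (asm) AE_iff_null_sets[symmetric]) (auto simp: sets)
  qed
  have distinct: "AE z in PiM {1..n} (\<lambda>_. P). inj_on (pair_dist z) (pairs_in {1..n})" for n :: nat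
    by (rule AE_PiM_inj_pair_dist[OF P sets sphere_null]) (rule finite_atLeastAtMost)
  let ?k = "real (kissing_number TYPE(real ^ 'd))"
  let ?min = "\<lambda>n \<omega>. Min {packing_number ((\<lambda>l. mst_minimizer q n (override_on (X n \<omega>) (X' n l \<omega>) {l})) ` A)
      (edge_dist n) \<epsilon> | A. A \<subseteq> {1..n} \<and> real (card A) > (1 - \<epsilon>) * real (card {1..n})}"
  \<comment> \<open>The constant 2 serves for all \<open>\<epsilon>\<close> and
    \<open>\<delta>\<close>: for large \<open>n\<close> the minimum is almost surely at most
    1.\<close>
  have zero: "measure (M n) {\<omega> \<in> space (M n). real (?min n \<omega>) \<ge> 2} = 0"
    if n: "3 \<le> n" "8 * ?k / \<epsilon> \<le> real n" for n
  proof (rule measure_eq_0_if_AE_not)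
    have small: "8 * ?k \<le> \<epsilon> * real n"
      using n(2) \<epsilon> by (simp add: field_simps)
    have rv: "X n \<in> M n \<rightarrow>\<^sub>M PiM {1..n} (\<lambda>_. borel)"
      using sample[of n] by (simp add: iid_sample_def)
    have law: "distr (M n) (PiM {1..n} (\<lambda>_. borel)) (X n) = PiM {1..n} (\<lambda>_. P)"
      using n(1) by (intro iid_sample_distr[OF M sample]) auto
    have "AE \<omega> in M n. inj_on (pair_dist (X n \<omega>)) (pairs_in {1..n})"
      by (rule AE_distrD[OF rv]) (unfold law, rule distinct)
    \<comment> \<open>Only the joint law of \<open>X n\<close> with one copy at a time enters; the
      finitely many \<open>l\<close> are combined by a union of null sets.\<close>
    moreover have "AE \<omega> in M n. \<forall>l\<in>{1..n}. inj_on (pair_dist ((X n \<omega>)(l := X' n l \<omega> l))) (pairs_in {1..n})"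
      by (intro AE_finite_allI AE_iid_sample_fun_upd[OF M P sample copies _ _ distinct]) auto
    ultimately show "AE \<omega> in M n. \<not> real (?min n \<omega>) \<ge> 2"
    proof eventually_elim
      case (elim \<omega>)
      have upd: "override_on (X n \<omega>) (X' n l \<omega>) {l} = (X n \<omega>)(l := X' n l \<omega> l)" for l
        by (auto simp: override_on_def)
      have "?min n \<omega> \<le> 1"
        unfolding upd using q(1) elim
        by (intro min_packing_number_le_1[OF _ n(1) \<epsilon> small]) auto
      then show ?case
        by linarith
    qed
  qed
  have "\<forall>\<^sub>F n in sequentially.
      ereal (measure (M n) {\<omega> \<in> space (M n). real (?min n \<omega>) \<ge> 2}) \<le> ereal \<delta>"
    using eventually_ge_at_top[of "3::nat"] eventually_ge_at_top[of "nat \<lceil>8 * ?k / \<epsilon>\<rceil>"]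
  proof eventually_elim
    case (elim n)
    then have "8 * ?k / \<epsilon> \<le> real n"
      by linarith
    from zero[OF elim(1) this] \<delta> show ?case
      by (simp only: ereal_less_eq)
  qed
  then show "\<exists>m::real. limsup (\<lambda>n. ereal (measure (M n) {\<omega> \<in> space (M n). real (?min n \<omega>) \<ge> m})) \<le> ereal \<delta>"
    by (intro exI[of _ 2] Limsup_bounded)
qed

end
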